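(* Fix $k\in\{1,\dots,K\}$ and an integer $Q\ge 2$. Let the full i.i.d. data set $\mathcal D$ of size $n$ be randomly partitioned into $Q$ disjoint sub-datasets $\mathcal D_1,\dots,\mathcal D_Q$ of sizes $n_q=|\mathcal D_q|$, let $T_{S\to M_k\leadsto Y}(\mathcal D_q)$ be Sobel's statistic (defined in the context) computed from $\mathcal D_q$, put $\overline T_{S\to M_k\leadsto Y}=\frac1Q\sum_{q=1}^QT_{S\to M_k\leadsto Y}(\mathcal D_q)$ and $$\widetilde T_{S\to M_k\leadsto Y}=\frac{Q^{1/2}\,\overline T_{S\to M_k\leadsto Y}}{\Big[\sum_{q=1}^Q\{T_{S\to M_k\leadsto Y}(\mathcal D_q)-\overline T_{S\to M_k\leadsto Y}\}^2/(Q-1)\Big]^{1/2}}.$$ Under the composite null hypothesis $H_0:\alpha_k\,\eta_{M_k\leadsto Y}=0$, one has $\widetilde T_{S\to M_k\leadsto Y}\xrightarrow{d}t_{Q-1}$ as $\min\{n_1,\dots,n_Q\}\to\infty$, where $t_{Q-1}$ is Student's $t$-distribution with $Q-1$ degrees of freedom. Moreover, in the case of an equal data split, $n_q=n/Q$ for all $q$, the asymptotic $t_{Q-1}$ distribution holds as $n\to\infty$.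
   Context: $S$ is an exposure, $M_1,\dots,M_K$ continuous mediators, $Y$ an outcome, $\boldsymbol W$ a covariate vector. Mediator model: $M_k=\alpha_kS+\sum_{j=1}^{k-1}\xi_{k\mid j}M_j+\boldsymbol\delta_{M_k}^T\boldsymbol W+\epsilon_{M_k}$, $k=1,\dots,K$, with mutually independent errors $\epsilon_{M_k}\sim\mathcal N(0,\sigma_{M_k}^2)$. Outcome model with linear predictor $L=\gamma_SS+\sum_{k}\beta_kM_k+\boldsymbol\delta_Y^T\boldsymbol W$: Gaussian linear ($Y=L+\epsilon_Y$, $\epsilon_Y\sim\mathcal N(0,\sigma_Y^2)$), probit, logistic, or log-linear Poisson/Negative Binomial. Composite coefficients: $\eta_{M_K\leadsto Y}=\beta_K$, $\eta_{M_k\leadsto Y}=\beta_k+\sum_{j=k+1}^K\xi_{j\mid k}\eta_{M_j\leadsto Y}$ for $k<K$. For a data set of $m$ i.i.d. observations, $\widehat\alpha_k$ is the maximum likelihood estimator of $\alpha_k$ and $\widehat\eta_{M_k\leadsto Y}$ is obtained by the same recursion from the maximum likelihood estimators of the $\beta$'s and $\xi$'s. Standing assumption: standard regularity conditions for maximum likelihood hold, under which $m^{1/2}(\widehat\alpha_k-\alpha_k,\widehat\eta_{M_k\leadsto Y}-\eta_{M_k\leadsto Y})$ converges in distribution, as $m\to\infty$, to a centered bivariate normal vector with independent components of positive variances $\sigma^2_{\alpha_k}$ and $\sigma^2_{\eta_{M_k\leadsto Y}}$; $\widehat\sigma^2_{\alpha_k}$ and $\widehat\sigma^2_{\eta_{M_k\leadsto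 Y}}$ are consistent estimators of these variances. With $T_{\alpha_k}=m^{1/2}\widehat\alpha_k/\widehat\sigma_{\alpha_k}$ and $T_{\eta_{M_k\leadsto Y}}=m^{1/2}\widehat\eta_{M_k\leadsto Y}/\widehat\sigma_{\eta_{M_k\leadsto Y}}$, Sobel's statistic is $$T_{S\to M_k\leadsto Y}=\frac{T_{\alpha_k}T_{\eta_{M_k\leadsto Y}}}{(T_{\alpha_k}^2+T_{\eta_{M_k\leadsto Y}}^2)^{1/2}};$$ for $\mathcal D_q$ all these quantities are computed from $\mathcal D_q$ alone, with $m=n_q$. The parameters are fixed (not depending on $n$), and the random partition is independent of the data. *)

theory Defs
  imports "HOL-Probability.Probability"
begin

section \<open>Probabilistic notions\<close>

text \<open>Independence of two random variables of possibly different types, spelled out as in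
  \<open>prob_space.indep_var_eq\<close>; the library's \<open>indep_var\<close> forces both variables to have the same
  type.\<close>

definition indep_rvs ::
  "'a measure \<Rightarrow> 'b measure \<Rightarrow> ('a \<Rightarrow> 'b) \<Rightarrow> 'c measure \<Rightarrow> ('a \<Rightarrow> 'c) \<Rightarrow> bool" where
  "indep_rvs P N X N' Y \<longleftrightarrow> X \<in> measurable P N \<and> Y \<in> measurable P N' \<and>
     prob_space.indep_set P
       (sigma_sets (space P) {X -` A \<inter> space P |A. A \<in> sets N})
       (sigma_sets (space P) {Y -` A \<inter> space P |A. A \<in> sets N'})"

text \<open>Weak convergence on an arbitrary topological space (the library's \<open>weak_conv_m\<close> covers
  laws on the real line only).\<close>

definition weak_conv_top :: "(nat \<Rightarrow> 'b::topological_space measure) \<Rightarrow> 'b measure \<Rightarrow> bool" where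
  "weak_conv_top \<mu>s \<mu> \<longleftrightarrow>
     (\<forall>f :: 'b \<Rightarrow> real. continuous_on UNIV f \<and> bounded (range f) \<longrightarrow>
        (\<lambda>m. \<integral>x. f x \<partial>(\<mu>s m)) \<longlonglongrightarrow> (\<integral>x. f x \<partial>\<mu>))"

definition conv_in_prob :: "'a measure \<Rightarrow> (nat \<Rightarrow> 'a \<Rightarrow> real) \<Rightarrow> real \<Rightarrow> bool" where
  "conv_in_prob P X c \<longleftrightarrow>
     (\<forall>e>0. (\<lambda>m. measure P {\<omega> \<in> space P. \<bar>X m \<omega> - c\<bar> > e}) \<longlonglongrightarrow> 0)"

definition student_t_density :: "real \<Rightarrow> real \<Rightarrow> real" where
  "student_t_density \<nu> x =
     Gamma ((\<nu> + 1) / 2) / (sqrt (\<nu> * pi) * Gamma (\<nu> / 2)) * (1 + x\<^sup>2 / \<nu>) powr (- (\<nu> + 1) / 2)"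

definition student_t :: "real \<Rightarrow> real measure" where
  "student_t \<nu> = density lborel (\<lambda>x. ennreal (student_t_density \<nu> x))"

section \<open>Observations and the mediation model\<close>

text \<open>One observation is \<open>(S, W, M, Y)\<close>, where \<open>M\<close> is defined on the index set \<open>{1..K}\<close>.\<close>

type_synonym 'p obs = "real \<times> (real^'p) \<times> (nat \<Rightarrow> real) \<times> real"

definition exposure :: "'p::finite obs \<Rightarrow> real" where "exposure z = fst z"
definition covariates :: "'p::finite obs \<Rightarrow> real^'p" where "covariates z = fst (snd z)"
definition mediators :: "'p::finite obs \<Rightarrow> nat \<Rightarrow> real" where "mediators z = fst (snd (snd z))"
definition outcome :: "'p::finite obs \<Rightarrow> real" where "outcome z = snd (snd (snd z))"

definition obs_space :: "nat \<Rightarrow> 'p::finite obs measure" where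
  "obs_space K = borel \<Otimes>\<^sub>M (borel \<Otimes>\<^sub>M ((\<Pi>\<^sub>M k\<in>{1..K}. borel) \<Otimes>\<^sub>M borel))"

text \<open>\<open>xi \<theta> k j\<close> is the coefficient of \<open>M\<^sub>j\<close> in the regression for \<open>M\<^sub>k\<close>. The nuisance parameter
  \<open>disp\<close> is the standard deviation of the outcome error in the Gaussian model and the size
  parameter of the negative binomial model (mean \<open>\<mu>\<close>, variance \<open>\<mu> + \<mu>\<^sup>2 / disp\<close>); the other
  outcome models do not depend on it.\<close>

record 'p params =
  alpha :: "nat \<Rightarrow> real"
  xi :: "nat \<Rightarrow> nat \<Rightarrow> real"
  delta_M :: "nat \<Rightarrow> real^'p"
  sigma_M :: "nat \<Rightarrow> real"
  gamma_S :: real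
  beta :: "nat \<Rightarrow> real"
  delta_Y :: "real^'p"
  disp :: real

definition param_space :: "nat \<Rightarrow> 'p::finite params set" where
  "param_space K = {\<theta>. (\<forall>k\<in>{1..K}. 0 < sigma_M \<theta> k) \<and> 0 < disp \<theta>}"

definition mediator_mean :: "'p::finite params \<Rightarrow> nat \<Rightarrow> 'p obs \<Rightarrow> real" where
  "mediator_mean \<theta> k z =
     alpha \<theta> k * exposure z + (\<Sum>j\<in>{1..<k}. xi \<theta> k j * mediators z j) + delta_M \<theta> k \<bullet> covariates z"

definition lin_pred :: "nat \<Rightarrow> 'p::finite params \<Rightarrow> 'p obs \<Rightarrow> real" where
  "lin_pred K \<theta> z =
     gamma_S \<theta> * exposure z + (\<Sum>k\<in>{1..K}. beta \<theta> k * mediators z k) + delta_Y \<theta> \<bullet> covariates z"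

definition mediator_error :: "'p::finite params \<Rightarrow> nat \<Rightarrow> 'p obs \<Rightarrow> real" where
  "mediator_error \<theta> k z = mediators z k - mediator_mean \<theta> k z"

text \<open>The empty sum gives the value \<open>\<beta>\<^sub>K\<close> at \<open>k = K\<close>.\<close>

function eta :: "nat \<Rightarrow> (nat \<Rightarrow> real) \<Rightarrow> (nat \<Rightarrow> nat \<Rightarrow> real) \<Rightarrow> nat \<Rightarrow> real" where
  "eta K b x k = b k + (\<Sum>j\<in>{k+1..K}. x j k * eta K b x j)"
  by auto
termination
  by (relation "Wellfounded.measure (\<lambda>(K, b, x, k). K - k)") auto

declare eta.simps [simp del]

definition composite :: "nat \<Rightarrow> 'p::finite params \<Rightarrow> nat \<Rightarrow> real" where
  "composite K \<theta> k = eta K (beta \<theta>) (xi \<theta>) k"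

datatype outcome_family =
  Gaussian_Linear | Probit | Logistic | Poisson_Loglinear | NegBin_Loglinear

text \<open>Conditional density (Gaussian model) or probability mass (all other models) of the outcome
  at \<open>y\<close>, given that the linear predictor equals \<open>l\<close>.\<close>

definition outcome_density :: "outcome_family \<Rightarrow> real \<Rightarrow> real \<Rightarrow> real \<Rightarrow> real" where
  "outcome_density fam d l y = (case fam of
     Gaussian_Linear \<Rightarrow> normal_density l d y
   | Probit \<Rightarrow> (if y = 1 then cdf std_normal_distribution l
               else if y = 0 then 1 - cdf std_normal_distribution l else 0)
   | Logistic \<Rightarrow> (if y = 1 then 1 / (1 + exp (- l))
                 else if y = 0 then 1 - 1 / (1 + exp (- l)) else 0)
   | Poisson_Loglinear \<Rightarrow>
       (if y \<in> \<nat> then pmf (poisson_pmf (exp l)) (nat \<lfloor>y\<rfloor>) else 0)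
   | NegBin_Loglinear \<Rightarrow>
       (if y \<in> \<nat> then Gamma (y + d) / (Gamma d * fact (nat \<lfloor>y\<rfloor>)) *
          (d / (d + exp l)) powr d * (exp l / (d + exp l)) ^ nat \<lfloor>y\<rfloor> else 0))"

definition mediator_model :: "nat \<Rightarrow> 'p::finite params \<Rightarrow> 'p obs measure \<Rightarrow> bool" where
  "mediator_model K \<theta> \<mu> \<longleftrightarrow>
     (\<forall>k\<in>{1..K}. distributed \<mu> lborel (mediator_error \<theta> k) (normal_density 0 (sigma_M \<theta> k))) \<and>
     prob_space.indep_vars \<mu> (\<lambda>_. borel) (mediator_error \<theta>) {1..K} \<and>
     indep_rvs \<mu> (borel \<Otimes>\<^sub>M borel) (\<lambda>z. (exposure z, covariates z))
       (\<Pi>\<^sub>M k\<in>{1..K}. borel) (\<lambda>z. \<lambda>k\<in>{1..K}. mediator_error \<theta> k z)"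

definition regressors :: "'p::finite obs \<Rightarrow> real \<times> (real^'p) \<times> (nat \<Rightarrow> real)" where
  "regressors z = (exposure z, covariates z, mediators z)"

definition regressor_space :: "nat \<Rightarrow> (real \<times> (real^'p::finite) \<times> (nat \<Rightarrow> real)) measure" where
  "regressor_space K = borel \<Otimes>\<^sub>M (borel \<Otimes>\<^sub>M (\<Pi>\<^sub>M k\<in>{1..K}. borel))"

text \<open>In the discrete models the conditional probability of \<open>Y = y\<close> given \<open>(S, W, M)\<close> is the model
  mass. The masses sum to one over the natural numbers, so \<open>Y\<close> is almost surely a natural number
  (zero or one in the binary models).\<close>

definition outcome_model ::
  "nat \<Rightarrow> outcome_family \<Rightarrow> 'p::finite params \<Rightarrow> 'p obs measure \<Rightarrow> bool" where
  "outcome_model K fam \<theta> \<mu> \<longleftrightarrow>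
     (if fam = Gaussian_Linear then
        distributed \<mu> lborel (\<lambda>z. outcome z - lin_pred K \<theta> z) (normal_density 0 (disp \<theta>)) \<and>
        indep_rvs \<mu> (regressor_space K) regressors borel (\<lambda>z. outcome z - lin_pred K \<theta> z)
      else
        (\<forall>y::nat. AE z in \<mu>.
           real_cond_exp \<mu> (vimage_algebra (space \<mu>) regressors (regressor_space K))
             (indicator {z \<in> space \<mu>. outcome z = real y}) z
           = outcome_density fam (disp \<theta>) (lin_pred K \<theta> z) (real y)))"

definition mediation_model ::
  "nat \<Rightarrow> outcome_family \<Rightarrow> 'p::finite params \<Rightarrow> 'p obs measure \<Rightarrow> bool" where
  "mediation_model K fam \<theta> \<mu> \<longleftrightarrow>
     prob_space \<mu> \<and> sets \<mu> = sets (obs_space K) \<and> \<theta> \<in> param_space K \<and>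
     mediator_model K \<theta> \<mu> \<and> outcome_model K fam \<theta> \<mu>"

section \<open>Maximum likelihood\<close>

text \<open>A data set of size \<open>m\<close> is a function on the index set \<open>{..<m}\<close>.\<close>

definition data_space :: "nat \<Rightarrow> nat \<Rightarrow> (nat \<Rightarrow> 'p::finite obs) measure" where
  "data_space K m = (\<Pi>\<^sub>M i\<in>{..<m}. obs_space K)"

text \<open>Likelihood of the mediators and the outcome given exposure and covariates; the law of
  exposure and covariates is left unspecified and does not involve the parameters.\<close>

definition likelihood ::
  "nat \<Rightarrow> outcome_family \<Rightarrow> nat \<Rightarrow> (nat \<Rightarrow> 'p::finite obs) \<Rightarrow> 'p params \<Rightarrow> real" where
  "likelihood K fam m x \<theta> =
     (\<Prod>i<m. (\<Prod>k\<in>{1..K}. normal_density (mediator_mean \<theta> k (x i)) (sigma_M \<theta> k) (mediators (x i) k))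
            * outcome_density fam (disp \<theta>) (lin_pred K \<theta> (x i)) (outcome (x i)))"

definition is_mle ::
  "nat \<Rightarrow> outcome_family \<Rightarrow> nat \<Rightarrow> (nat \<Rightarrow> 'p::finite obs) \<Rightarrow> 'p params \<Rightarrow> bool" where
  "is_mle K fam m x \<theta> \<longleftrightarrow>
     \<theta> \<in> param_space K \<and> (\<forall>\<theta>'\<in>param_space K. likelihood K fam m x \<theta>' \<le> likelihood K fam m x \<theta>)"

text \<open>The likelihood need not have a maximum for every data set (small samples, separated binary
  outcomes). On such data sets the value of the estimator is unconstrained.\<close>

definition mle_estimator ::
  "nat \<Rightarrow> outcome_family \<Rightarrow> (nat \<Rightarrow> (nat \<Rightarrow> 'p::finite obs) \<Rightarrow> 'p params) \<Rightarrow> bool" where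
  "mle_estimator K fam est \<longleftrightarrow>
     (\<forall>m. \<forall>x\<in>space (data_space K m).
        (\<exists>\<theta>. is_mle K fam m x \<theta>) \<longrightarrow> is_mle K fam m x (est m x))"

section \<open>Sobel's statistic and its split version\<close>

definition sobel :: "real \<Rightarrow> real \<Rightarrow> real" where
  "sobel a b = a * b / sqrt (a\<^sup>2 + b\<^sup>2)"

text \<open>The arguments \<open>va\<close> and \<open>ve\<close> are the estimators of the asymptotic variances of the
  estimators of \<open>\<alpha>\<^sub>k\<close> and of the composite coefficient.\<close>

definition sobel_stat ::
  "nat \<Rightarrow> nat \<Rightarrow> (nat \<Rightarrow> (nat \<Rightarrow> 'p::finite obs) \<Rightarrow> 'p params) \<Rightarrow>
   (nat \<Rightarrow> (nat \<Rightarrow> 'p obs) \<Rightarrow> real) \<Rightarrow> (nat \<Rightarrow> (nat \<Rightarrow> 'p obs) \<Rightarrow> real) \<Rightarrow>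
   nat \<Rightarrow> (nat \<Rightarrow> 'p obs) \<Rightarrow> real" where
  "sobel_stat K k est va ve m x =
     sobel (sqrt (real m) * alpha (est m x) k / sqrt (va m x))
           (sqrt (real m) * composite K (est m x) k / sqrt (ve m x))"

text \<open>The observations with indices in \<open>I\<close>, enumerated in increasing order of their index.\<close>

definition subdata :: "nat set \<Rightarrow> (nat \<Rightarrow> 'b) \<Rightarrow> nat \<Rightarrow> 'b" where
  "subdata I x = (\<lambda>j\<in>{..<card I}. x (sorted_list_of_set I ! j))"

definition split_mean :: "nat \<Rightarrow> (nat \<Rightarrow> real) \<Rightarrow> real" where
  "split_mean Q T = (\<Sum>q\<in>{1..Q}. T q) / real Q"

definition split_t :: "nat \<Rightarrow> (nat \<Rightarrow> real) \<Rightarrow> real" where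
  "split_t Q T = sqrt (real Q) * split_mean Q T /
     sqrt ((\<Sum>q\<in>{1..Q}. (T q - split_mean Q T)\<^sup>2) / (real Q - 1))"

text \<open>\<open>D q \<omega>\<close> is the set of indices of the observations assigned to the \<open>q\<close>-th sub-dataset, which
  has the prescribed size \<open>N q\<close>. Apart from independence of the data, the law of the partition
  is arbitrary.\<close>

definition random_partition ::
  "'a measure \<Rightarrow> nat \<Rightarrow> (nat \<Rightarrow> 'a \<Rightarrow> 'p::finite obs) \<Rightarrow> nat \<Rightarrow> (nat \<Rightarrow> nat) \<Rightarrow>
   (nat \<Rightarrow> 'a \<Rightarrow> nat set) \<Rightarrow> bool" where
  "random_partition P K Z Q N D \<longleftrightarrow>
     (let n = (\<Sum>q\<in>{1..Q}. N q) in
       (\<forall>\<omega>\<in>space P. (\<Union>q\<in>{1..Q}. D q \<omega>) = {..<n} \<and>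
          disjoint_family_on (\<lambda>q. D q \<omega>) {1..Q} \<and> (\<forall>q\<in>{1..Q}. card (D q \<omega>) = N q)) \<and>
       indep_rvs P (data_space K n) (\<lambda>\<omega>. \<lambda>i\<in>{..<n}. Z i \<omega>)
         (count_space UNIV) (\<lambda>\<omega>. \<lambda>q\<in>{1..Q}. D q \<omega>))"

definition split_sobel ::
  "nat \<Rightarrow> nat \<Rightarrow> (nat \<Rightarrow> (nat \<Rightarrow> 'p::finite obs) \<Rightarrow> 'p params) \<Rightarrow>
   (nat \<Rightarrow> (nat \<Rightarrow> 'p obs) \<Rightarrow> real) \<Rightarrow> (nat \<Rightarrow> (nat \<Rightarrow> 'p obs) \<Rightarrow> real) \<Rightarrow>
   (nat \<Rightarrow> 'a \<Rightarrow> 'p obs) \<Rightarrow> nat \<Rightarrow> (nat \<Rightarrow> nat) \<Rightarrow> (nat \<Rightarrow> 'a \<Rightarrow> nat set) \<Rightarrow> 'a \<Rightarrow> real" where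
  "split_sobel K k est va ve Z Q N D \<omega> =
     split_t Q (\<lambda>q. sobel_stat K k est va ve (N q) (subdata (D q \<omega>) (\<lambda>i. Z i \<omega>)))"

end

theory Submission
  imports Defs
begin

text \<open>Each sub-statistic converges in law to a centred normal variable whose variance is 1 or 1/4:
  if exactly one of the two parameters vanishes, Sobel's statistic is asymptotically the standardised
  estimator of that parameter, up to sign; if both vanish, its limit is \<open>U V / sqrt (U\<^sup>2 + V\<^sup>2)\<close> for
  independent standard normal \<open>U, V\<close>, which is half of \<open>R sin (2\<phi>)\<close> in polar coordinates and hence
  \<open>N(0, 1/4)\<close>. The variance is the same in all sub-datasets, the sub-statistics are independent, and
  the split \<open>t\<close>-statistic is invariant under scaling; so its limit is the \<open>t\<close>-statistic of \<open>Q\<close>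
  independent standard normal variables.\<close>

section \<open>Rotation invariance of the Gaussian plane\<close>

text \<open>The data do not reveal which null case holds, hence whether the limiting standard
  deviation is 1 or 1/2; the empirical standard deviation of the sub-statistics cancels it, at the
  price of a Student limit. One computation carries both distributional facts: the Gaussian plane is
  invariant under the reflection (x, y) -> (c x + s y, s x - c y) with c^2 + s^2 = 1. It stands in
  for polar coordinates in the law of the Sobel limit and, applied once per observation, it
  separates the mean of a normal sample from its sum of squares. The passage to the limit meets two
  obstacles. The block sizes grow at unrelated rates, so the exact law of the split statistic is
  identified as the image of a product of laws, and each factor has its own limit. And
  \<open>split_t\<close> is discontinuous where all its arguments coincide, a set that the normal
  limit avoids almost surely because \<open>Q \<ge> 2\<close>.\<close>

lemma std_normal_reflection_nonzero:
  fixes f :: "real \<times> real \<Rightarrow> ennreal"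
  assumes [measurable]: "f \<in> borel_measurable (borel \<Otimes>\<^sub>M borel)"
    and cs: "c\<^sup>2 + s\<^sup>2 = 1" and c: "c \<noteq> 0"
  shows "(\<integral>\<^sup>+x. \<integral>\<^sup>+y. f (c * x + s * y, s * x - c * y) \<partial>std_normal_distribution \<partial>std_normal_distribution)
       = (\<integral>\<^sup>+x. \<integral>\<^sup>+y. f (x, y) \<partial>std_normal_distribution \<partial>std_normal_distribution)"
proof -
  define \<rho> where "\<rho> x y = ennreal (1 / (2 * pi) * exp (- (x\<^sup>2 + y\<^sup>2) / 2))" for x y :: real
  have \<rho>: "ennreal (std_normal_density x) * ennreal (std_normal_density y) = \<rho> x y" for x y
    by (simp add: \<rho>_def std_normal_density_def field_simps flip: ennreal_mult exp_add)
  have [measurable]: "case_prod \<rho> \<in> borel_measurable (borel \<Otimes>\<^sub>M borel)"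
    unfolding \<rho>_def by measurable
  have dens: "(\<integral>\<^sup>+x. \<integral>\<^sup>+y. g (x, y) \<partial>std_normal_distribution \<partial>std_normal_distribution)
     = (\<integral>\<^sup>+x. \<integral>\<^sup>+y. \<rho> x y * g (x, y) \<partial>lborel \<partial>lborel)"
    if [measurable]: "g \<in> borel_measurable (borel \<Otimes>\<^sub>M borel)" for g :: "real \<times> real \<Rightarrow> ennreal"
    by (simp add: nn_integral_density nn_integral_cmult mult.assoc flip: \<rho>)
  \<comment> \<open>The map is inverted by two affine substitutions on the line, first v = s x - c y
    for y, then u = (x - s v) / c for x; the point in this fact is the result of both. Their
    Jacobians 1/|c| and |c| cancel, and c \<noteq> 0 is needed to solve for y.\<close>
  have \<rho>_inv: "\<rho> (s * v + c * u) ((s * (s * v + c * u) - v) / c) = \<rho> u v" for u v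
  proof -
    have "s * (s * v + c * u) - v = c * (s * u - c * v)"
      using cs by algebra
    then have e: "(s * (s * v + c * u) - v) / c = s * u - c * v" using c by simp
    have "(s * v + c * u)\<^sup>2 + (s * u - c * v)\<^sup>2 = u\<^sup>2 + v\<^sup>2"
      using cs by algebra
    then show ?thesis unfolding e \<rho>_def by simp
  qed
  have "(\<integral>\<^sup>+y. \<rho> x y * f (c * x + s * y, s * x - c * y) \<partial>lborel)
      = \<bar>- 1 / c\<bar> * (\<integral>\<^sup>+v. \<rho> x ((s * x - v) / c) * f ((x - s * v) / c, v) \<partial>lborel)" for x
  proof -
    have "c * (c * x + s * ((s * x - v) / c)) = c\<^sup>2 * x + s * (s * x - v)" for v
      using c by (simp add: power2_eq_square distrib_left)
    also have "\<dots> v = x - s * v" for v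
      using cs by algebra
    finally have 2: "c * x + s * ((s * x - v) / c) = (x - s * v) / c" for v
      using c by (metis nonzero_mult_div_cancel_left)
    have 3: "s * x - c * ((s * x - v) / c) = v" for v
      using c by simp
    show ?thesis
      using c by (subst nn_integral_real_affine[where c = "- 1 / c" and t = "s * x / c"])
         (simp_all add: 2[unfolded times_divide_eq_right] 3[unfolded times_divide_eq_right] flip: diff_divide_distrib)
  qed
  then have "(\<integral>\<^sup>+x. \<integral>\<^sup>+y. f (c * x + s * y, s * x - c * y) \<partial>std_normal_distribution \<partial>std_normal_distribution)
     = \<bar>- 1 / c\<bar> * (\<integral>\<^sup>+x. \<integral>\<^sup>+v. \<rho> x ((s * x - v) / c) * f ((x - s * v) / c, v) \<partial>lborel \<partial>lborel)"
    by (subst dens[of "\<lambda>(x, y). f (c * x + s * y, s * x - c * y)", simplified])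
       (simp_all add: nn_integral_cmult)
  also have "(\<integral>\<^sup>+x. \<integral>\<^sup>+v. \<rho> x ((s * x - v) / c) * f ((x - s * v) / c, v) \<partial>lborel \<partial>lborel)
     = (\<integral>\<^sup>+v. \<integral>\<^sup>+x. \<rho> x ((s * x - v) / c) * f ((x - s * v) / c, v) \<partial>lborel \<partial>lborel)"
    by (intro lborel_pair.Fubini'[symmetric]) measurable
  also have "(\<lambda>v. \<integral>\<^sup>+x. \<rho> x ((s * x - v) / c) * f ((x - s * v) / c, v) \<partial>lborel)
     = (\<lambda>v. \<bar>c\<bar> * (\<integral>\<^sup>+u. \<rho> u v * f (u, v) \<partial>lborel))"
  proof
    show "(\<integral>\<^sup>+x. \<rho> x ((s * x - v) / c) * f ((x - s * v) / c, v) \<partial>lborel)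
       = \<bar>c\<bar> * (\<integral>\<^sup>+u. \<rho> u v * f (u, v) \<partial>lborel)" for v
      using c by (subst nn_integral_real_affine[where c = c and t = "s * v"]) (simp_all add: \<rho>_inv)
  qed
  also have "\<bar>- 1 / c\<bar> * (\<integral>\<^sup>+v. \<bar>c\<bar> * (\<integral>\<^sup>+u. \<rho> u v * f (u, v) \<partial>lborel) \<partial>lborel)
     = (\<integral>\<^sup>+v. \<integral>\<^sup>+u. \<rho> u v * f (u, v) \<partial>lborel \<partial>lborel)"
    using c by (simp add: nn_integral_cmult flip: mult.assoc ennreal_mult)
  also have "\<dots> = (\<integral>\<^sup>+u. \<integral>\<^sup>+v. \<rho> u v * f (u, v) \<partial>lborel \<partial>lborel)"
    by (intro lborel_pair.Fubini') measurable
  finally show ?thesis by (simp add: dens)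
qed

lemma nn_integral_std_normal_uminus:
  assumes [measurable]: "f \<in> borel_measurable borel"
  shows "(\<integral>\<^sup>+x. f (- x) \<partial>std_normal_distribution) = (\<integral>\<^sup>+x. f x \<partial>std_normal_distribution)"
proof -
  have "(\<integral>\<^sup>+x. f x \<partial>std_normal_distribution) = (\<integral>\<^sup>+x. ennreal (std_normal_density x) * f x \<partial>lborel)"
    by (simp add: nn_integral_density)
  also have "\<dots> = (\<integral>\<^sup>+x. ennreal (std_normal_density x) * f (- x) \<partial>lborel)"
    by (subst nn_integral_real_affine[where c = "-1" and t = 0]) (simp_all add: std_normal_density_def)
  also have "\<dots> = (\<integral>\<^sup>+x. f (- x) \<partial>std_normal_distribution)"
    by (simp add: nn_integral_density)
  finally show ?thesis by simp
qed

lemma pair_sigma_finite_std_normal: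
  "pair_sigma_finite std_normal_distribution std_normal_distribution"
proof -
  interpret prob_space std_normal_distribution by (rule prob_space_normal_density) simp
  show ?thesis by unfold_locales
qed

text \<open>The remaining case c = 0 forces s = 1 or s = -1, where the map exchanges the coordinates
  up to a common sign; Fubini and the symmetry of the normal law settle it.\<close>

lemma std_normal_reflection:
  fixes f :: "real \<times> real \<Rightarrow> ennreal"
  assumes [measurable]: "f \<in> borel_measurable (borel \<Otimes>\<^sub>M borel)" and cs: "c\<^sup>2 + s\<^sup>2 = 1"
  shows "(\<integral>\<^sup>+x. \<integral>\<^sup>+y. f (c * x + s * y, s * x - c * y) \<partial>std_normal_distribution \<partial>std_normal_distribution)
       = (\<integral>\<^sup>+x. \<integral>\<^sup>+y. f (x, y) \<partial>std_normal_distribution \<partial>std_normal_distribution)"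
proof (cases "c = 0")
  case True
  interpret pair_sigma_finite std_normal_distribution std_normal_distribution
    by (rule pair_sigma_finite_std_normal)
  have "(\<integral>\<^sup>+x. \<integral>\<^sup>+y. f (s * y, s * x) \<partial>std_normal_distribution \<partial>std_normal_distribution)
      = (\<integral>\<^sup>+y. \<integral>\<^sup>+x. f (s * y, s * x) \<partial>std_normal_distribution \<partial>std_normal_distribution)"
    by (intro Fubini'[symmetric]) measurable
  moreover from True cs have "s = 1 \<or> s = - 1" by (simp add: power2_eq_1_iff)
  ultimately show ?thesis
    using True
      nn_integral_std_normal_uminus[of "\<lambda>y. \<integral>\<^sup>+x. f (y, - x) \<partial>std_normal_distribution"]
      nn_integral_std_normal_uminus[of "\<lambda>x. f (_, x)"]
    by auto
qed (use assms std_normal_reflection_nonzero in blast)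

abbreviation std_normal_pair :: "(real \<times> real) measure" where
  "std_normal_pair \<equiv> std_normal_distribution \<Otimes>\<^sub>M std_normal_distribution"

lemma prob_space_std_normal: "prob_space std_normal_distribution"
  by (rule prob_space_normal_density) simp

lemma prob_space_std_normal_pair: "prob_space std_normal_pair"
  by (intro prob_space_pair prob_space_std_normal)

lemma nn_integral_std_normal_pair:
  fixes f :: "real \<times> real \<Rightarrow> ennreal"
  assumes "f \<in> borel_measurable (borel \<Otimes>\<^sub>M borel)"
  shows "(\<integral>\<^sup>+z. f z \<partial>std_normal_pair)
    = (\<integral>\<^sup>+x. \<integral>\<^sup>+y. f (x, y) \<partial>std_normal_distribution \<partial>std_normal_distribution)"
proof -
  interpret prob_space std_normal_distribution by (rule prob_space_std_normal)
  have "sets (borel \<Otimes>\<^sub>M borel) = sets std_normal_pair"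
    by (intro sets_pair_measure_cong) auto
  then show ?thesis
    using assms by (intro nn_integral_fst[symmetric]) (simp cong: measurable_cong_sets)
qed

lemma std_normal_pair_reflection:
  fixes f :: "real \<times> real \<Rightarrow> ennreal"
  assumes [measurable]: "f \<in> borel_measurable (borel \<Otimes>\<^sub>M borel)" and cs: "c\<^sup>2 + s\<^sup>2 = 1"
  shows "(\<integral>\<^sup>+z. f (c * fst z + s * snd z, s * fst z - c * snd z) \<partial>std_normal_pair)
       = (\<integral>\<^sup>+z. f z \<partial>std_normal_pair)"
  using std_normal_reflection[OF assms] by (simp add: nn_integral_std_normal_pair)

lemma sets_std_normal_pair [measurable_cong]:
  "sets std_normal_pair = sets (borel \<Otimes>\<^sub>M borel)"
  by (intro sets_pair_measure_cong) auto

lemma AE_std_normal_neq: "AE x in std_normal_distribution. x \<noteq> c"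
proof -
  have "AE x in lborel. x \<noteq> c" by (rule AE_lborel_singleton)
  then show ?thesis by (subst AE_density) auto
qed

lemma AE_std_normal_pair_neq: "AE z in std_normal_pair. fst z \<noteq> 0"
proof -
  interpret pair_sigma_finite std_normal_distribution std_normal_distribution
    by (rule pair_sigma_finite_std_normal)
  have "AE x in std_normal_distribution. AE y in std_normal_distribution. fst (x, y) \<noteq> 0"
    using AE_std_normal_neq[of 0] by eventually_elim simp
  then show ?thesis
    by (intro AE_pair_measure; measurable)
qed

text \<open>Averaging over an independent Gaussian direction: a rotation-invariant random point of the
  plane is determined in law by its radius.\<close>

lemma radial_law:
  fixes H1 H2 :: "real \<times> real \<Rightarrow> real" and f :: "real \<Rightarrow> ennreal"
  assumes [measurable]: "H1 \<in> borel_measurable (borel \<Otimes>\<^sub>M borel)"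
      "H2 \<in> borel_measurable (borel \<Otimes>\<^sub>M borel)" "f \<in> borel_measurable borel"
    and radius: "\<And>z. (H1 z)\<^sup>2 + (H2 z)\<^sup>2 = (fst z)\<^sup>2 + (snd z)\<^sup>2"
    and inv: "\<And>C S. C\<^sup>2 + S\<^sup>2 = 1 \<Longrightarrow>
      (\<integral>\<^sup>+z. f (C * H1 z + S * H2 z) \<partial>std_normal_pair) = (\<integral>\<^sup>+z. f (H1 z) \<partial>std_normal_pair)"
  shows "(\<integral>\<^sup>+z. f (H1 z) \<partial>std_normal_pair) =
    (\<integral>\<^sup>+z. \<integral>\<^sup>+w. f (sqrt ((fst z)\<^sup>2 + (snd z)\<^sup>2) * fst w / sqrt ((fst w)\<^sup>2 + (snd w)\<^sup>2))
       \<partial>std_normal_pair \<partial>std_normal_pair)"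
proof -
  interpret N: prob_space std_normal_pair by (rule prob_space_std_normal_pair)
  interpret NN: pair_sigma_finite std_normal_pair std_normal_pair by unfold_locales
  define n where "n z = sqrt ((fst z)\<^sup>2 + (snd z)\<^sup>2)" for z :: "real \<times> real"
  have [measurable]: "n \<in> borel_measurable (borel \<Otimes>\<^sub>M borel)"
    unfolding n_def by measurable
  have "(\<integral>\<^sup>+z. f (H1 z) \<partial>std_normal_pair)
      = (\<integral>\<^sup>+w. \<integral>\<^sup>+z. f (H1 z) \<partial>std_normal_pair \<partial>std_normal_pair)"
    by (simp add: N.emeasure_space_1)
  \<comment> \<open>For fixed w the unit vector w / n w serves as (C, S) in \<open>inv\<close>; it
    is defined off the null set where fst w = 0.\<close>
  also have "\<dots> = (\<integral>\<^sup>+w. \<integral>\<^sup>+z. f ((fst w * H1 z + snd w * H2 z) / n w) \<partial>std_normal_pair \<partial>std_normal_pair)"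
  proof (rule nn_integral_cong_AE, use AE_std_normal_pair_neq in eventually_elim)
    case (elim w)
    then have "0 < n w" by (simp add: n_def sum_power2_gt_zero_iff)
    moreover have "(n w)\<^sup>2 = (fst w)\<^sup>2 + (snd w)\<^sup>2" by (simp add: n_def)
    then have "(fst w / n w)\<^sup>2 + (snd w / n w)\<^sup>2 = (n w)\<^sup>2 / (n w)\<^sup>2"
      by (simp only: power_divide add_divide_distrib)
    ultimately have "(fst w / n w)\<^sup>2 + (snd w / n w)\<^sup>2 = 1" by simp
    from inv[OF this] show ?case by (simp add: add_divide_distrib)
  qed
  also have "\<dots> = (\<integral>\<^sup>+z. \<integral>\<^sup>+w. f ((fst w * H1 z + snd w * H2 z) / n w) \<partial>std_normal_pair \<partial>std_normal_pair)"
    by (intro NN.Fubini') measurable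
  also have "\<dots> = (\<integral>\<^sup>+z. \<integral>\<^sup>+w. f (n z * fst w / n w) \<partial>std_normal_pair \<partial>std_normal_pair)"
  proof (rule nn_integral_cong)
    fix z :: "real \<times> real"
    have nz: "(n z)\<^sup>2 = (H1 z)\<^sup>2 + (H2 z)\<^sup>2" by (simp add: n_def radius)
    show "(\<integral>\<^sup>+w. f ((fst w * H1 z + snd w * H2 z) / n w) \<partial>std_normal_pair)
        = (\<integral>\<^sup>+w. f (n z * fst w / n w) \<partial>std_normal_pair)"
    proof (cases "n z = 0")
      case True
      then show ?thesis using nz by (simp add: sum_power2_eq_zero_iff)
    next
      case False
      \<comment> \<open>For fixed z the roles change: (c, s) is the direction of the point (H1 z, H2
        z), and reflecting w turns c * fst w + s * snd w into fst w without changing n w. Only the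
        radius n z survives.\<close>
      define c s where "c = H1 z / n z" and "s = H2 z / n z"
      have H: "H1 z = n z * c" "H2 z = n z * s" using False by (auto simp: c_def s_def)
      have "(n z)\<^sup>2 * (c\<^sup>2 + s\<^sup>2) = (n z)\<^sup>2 * 1"
        using nz by (simp add: H power_mult_distrib distrib_left)
      then have cs: "c\<^sup>2 + s\<^sup>2 = 1" using False by simp
      have "(c * fst w + s * snd w)\<^sup>2 + (s * fst w - c * snd w)\<^sup>2 = (fst w)\<^sup>2 + (snd w)\<^sup>2"
        for w :: "real \<times> real" using cs by algebra
      then have "n (c * fst w + s * snd w, s * fst w - c * snd w) = n w" for w
        by (simp add: n_def)
      with std_normal_pair_reflection[OF _ cs, of "\<lambda>w. f (n z * fst w / n w)"]
      show ?thesis by (simp add: H algebra_simps)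
    qed
  qed
  finally show ?thesis by (simp add: n_def)
qed

text \<open>The point with polar coordinates \<open>(R, 2\<phi>)\<close> has the law of the one with coordinates \<open>(R, \<phi>)\<close>,
  and its second coordinate is \<open>2 u v / sqrt (u\<^sup>2 + v\<^sup>2)\<close>.\<close>

lemma nn_integral_sobel_std_normal_pair:
  fixes f :: "real \<Rightarrow> ennreal"
  assumes [measurable]: "f \<in> borel_measurable borel"
  shows "(\<integral>\<^sup>+z. f (2 * (fst z * snd z / sqrt ((fst z)\<^sup>2 + (snd z)\<^sup>2))) \<partial>std_normal_pair)
    = (\<integral>\<^sup>+x. f x \<partial>std_normal_distribution)"
proof -
  interpret prob_space std_normal_distribution by (rule prob_space_std_normal)
  define n where "n z = sqrt ((fst z)\<^sup>2 + (snd z)\<^sup>2)" for z :: "real \<times> real"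
  define p where "p z = ((fst z)\<^sup>2 - (snd z)\<^sup>2) / n z" for z :: "real \<times> real"
  define q where "q z = 2 * (fst z * snd z / n z)" for z :: "real \<times> real"
  have [measurable]: "n \<in> borel_measurable (borel \<Otimes>\<^sub>M borel)"
    unfolding n_def by measurable
  have [measurable]: "p \<in> borel_measurable (borel \<Otimes>\<^sub>M borel)"
    unfolding p_def by measurable
  have [measurable]: "q \<in> borel_measurable (borel \<Otimes>\<^sub>M borel)"
    unfolding q_def by measurable
  have n2: "(n z)\<^sup>2 = (fst z)\<^sup>2 + (snd z)\<^sup>2" for z by (simp add: n_def)
  have radius: "(p z)\<^sup>2 + (q z)\<^sup>2 = (fst z)\<^sup>2 + (snd z)\<^sup>2" for z
  proof (cases "n z = 0")
    case False
    have e: "((fst z)\<^sup>2 - (snd z)\<^sup>2)\<^sup>2 + (2 * (fst z * snd z))\<^sup>2 = (n z)\<^sup>2 * (n z)\<^sup>2"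
      unfolding n2 by algebra
    have "(p z)\<^sup>2 + (q z)\<^sup>2
        = (((fst z)\<^sup>2 - (snd z)\<^sup>2)\<^sup>2 + (2 * (fst z * snd z))\<^sup>2) / (n z)\<^sup>2"
      by (simp add: p_def q_def power_divide power_mult_distrib add_divide_distrib)
    also have "\<dots> = (n z)\<^sup>2"
      unfolding e using False by (intro nonzero_mult_div_cancel_left) simp
    finally have "(p z)\<^sup>2 + (q z)\<^sup>2 = (n z)\<^sup>2" .
    then show ?thesis by (simp add: n2)
  qed (use n2[of z] in \<open>simp add: p_def q_def\<close>)
  have inv: "(\<integral>\<^sup>+z. f (C * p z + S * q z) \<partial>std_normal_pair) = (\<integral>\<^sup>+z. f (p z) \<partial>std_normal_pair)"
    if CS: "C\<^sup>2 + S\<^sup>2 = 1" for C S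
  proof -
    \<comment> \<open>Half-angle formulas: if (C, S) = (cos t, sin t), then (c, s) = (cos (t/2), sin
      (t/2)). At C = -1 the formula s = S / (2 c) would divide by zero, so (0, 1) is given directly.
      The reflection sends the angle \<phi> to t/2 - \<phi>, hence 2 \<phi> to t - 2 \<phi>, whose
      cosine times the radius is C * p z + S * q z.\<close>
    obtain c s where c: "c\<^sup>2 - s\<^sup>2 = C" "2 * c * s = S" "c\<^sup>2 + s\<^sup>2 = 1"
    proof (cases "C = -1")
      case True
      with CS that[of 0 1] show ?thesis by simp
    next
      case False
      define c where "c = sqrt ((1 + C) / 2)"
      have "C\<^sup>2 \<le> 1" using CS zero_le_power2[of S] by linarith
      then have "- 1 \<le> C" by (simp add: abs_square_le_1 abs_le_iff)
      with False have c0: "c > 0" and c2: "c\<^sup>2 = (1 + C) / 2" by (auto simp: c_def)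
      have "S\<^sup>2 = (1 - C) * (1 + C)" using CS by (simp add: algebra_simps power2_eq_square)
      then have "(S / (2 * c))\<^sup>2 = (1 - C) * (1 + C) / (4 * ((1 + C) / 2))"
        by (simp add: power_divide power_mult_distrib c2)
      also have "\<dots> = (1 - C) / 2"
        using False \<open>- 1 \<le> C\<close> by (simp add: divide_simps)
      finally show ?thesis
        using c0 by (intro that[of c "S / (2 * c)"]) (simp_all add: c2 field_simps)
    qed
    have e: "(c * fst z + s * snd z)\<^sup>2 + (s * fst z - c * snd z)\<^sup>2 = (fst z)\<^sup>2 + (snd z)\<^sup>2"
      for z :: "real \<times> real" using c(3) by algebra
    have "(c * x + s * y)\<^sup>2 - (s * x - c * y)\<^sup>2 = C * (x\<^sup>2 - y\<^sup>2) + S * (2 * (x * y))" for x y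
      unfolding c(1,2)[symmetric] by (simp add: power2_eq_square algebra_simps)
    then have "p (c * fst z + s * snd z, s * fst z - c * snd z) = C * p z + S * q z" for z
      by (simp add: p_def q_def n_def e add_divide_distrib)
    with std_normal_pair_reflection[OF _ c(3), of "\<lambda>z. f (p z)"] show ?thesis by simp
  qed
  have inv': "(\<integral>\<^sup>+z. f (C * fst z + S * snd z) \<partial>std_normal_pair) = (\<integral>\<^sup>+z. f (fst z) \<partial>std_normal_pair)"
    if CS: "C\<^sup>2 + S\<^sup>2 = 1" for C S
    using std_normal_pair_reflection[OF _ CS, of "\<lambda>z. f (fst z)"] by simp
  have "(\<integral>\<^sup>+z. f (q z) \<partial>std_normal_pair) = (\<integral>\<^sup>+z. f (p z) \<partial>std_normal_pair)"
    using inv[of 0 1] by simp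
  \<comment> \<open>Both (p, q) and (fst, snd) are rotation invariant with the same radius, so
    \<open>radial_law\<close> gives them one and the same right-hand side.\<close>
  also have "\<dots> = (\<integral>\<^sup>+z. f (fst z) \<partial>std_normal_pair)"
    by (rule trans[OF radial_law[of p q f] radial_law[of fst snd f, symmetric]])
       (simp_all add: radius inv inv')
  also have "\<dots> = (\<integral>\<^sup>+x. f x \<partial>std_normal_distribution)"
    by (subst nn_integral_std_normal_pair) (simp_all add: emeasure_space_1[simplified])
  finally show ?thesis by (simp add: q_def n_def)
qed

section \<open>The \<open>t\<close>-statistic of a normal sample\<close>

text \<open>Built one squared normal at a time, to match the recursion for the sum of squared
  deviations of a sample, which is 0 for a single observation. Its density is never computed; the
  exponential tilts below suffice for the Student law.\<close>

primrec chi_squared :: "nat \<Rightarrow> real measure" where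
  "chi_squared 0 = return borel 0"
| "chi_squared (Suc n) = distr (chi_squared n \<Otimes>\<^sub>M std_normal_distribution) borel (\<lambda>(v, b). v + b\<^sup>2)"

lemma sets_chi_squared [measurable_cong, simp]: "sets (chi_squared n) = sets borel"
  by (cases n) simp_all

lemma space_chi_squared [simp]: "space (chi_squared n) = UNIV"
  by (cases n) simp_all

lemma measurable_chi_squared_step: "(\<lambda>(v, b). v + b\<^sup>2) \<in> chi_squared n \<Otimes>\<^sub>M std_normal_distribution \<rightarrow>\<^sub>M borel"
  by measurable

lemma prob_space_chi_squared: "prob_space (chi_squared n)"
proof (induction n)
  case (Suc n)
  then interpret prob_space "chi_squared n \<Otimes>\<^sub>M std_normal_distribution"
    by (intro prob_space_pair prob_space_std_normal)
  show ?case
    by (simp add: prob_space_distr measurable_chi_squared_step)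
qed (simp add: prob_space_return)

lemma pair_sigma_finite_chi_squared: "pair_sigma_finite (chi_squared n) std_normal_distribution"
proof -
  interpret prob_space "chi_squared n" by (rule prob_space_chi_squared)
  interpret N: prob_space std_normal_distribution by (rule prob_space_std_normal)
  show ?thesis by unfold_locales
qed

lemma nn_integral_chi_squared_Suc:
  assumes [measurable]: "f \<in> borel_measurable borel"
  shows "(\<integral>\<^sup>+v. f v \<partial>chi_squared (Suc n)) = (\<integral>\<^sup>+v. \<integral>\<^sup>+b. f (v + b\<^sup>2) \<partial>std_normal_distribution \<partial>chi_squared n)"
proof -
  interpret N: prob_space std_normal_distribution by (rule prob_space_std_normal)
  have "(\<integral>\<^sup>+v. f v \<partial>chi_squared (Suc n))
      = (\<integral>\<^sup>+z. f (case z of (v, b) \<Rightarrow> v + b\<^sup>2) \<partial>(chi_squared n \<Otimes>\<^sub>M std_normal_distribution))"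
    by (simp add: nn_integral_distr measurable_chi_squared_step)
  also have "\<dots> = (\<integral>\<^sup>+v. \<integral>\<^sup>+b. f (v + b\<^sup>2) \<partial>std_normal_distribution \<partial>chi_squared n)"
    by (subst N.nn_integral_fst[symmetric]) simp_all
  finally show ?thesis .
qed

text \<open>Positivity at \<open>Suc n\<close> needs only nonnegativity at \<open>n\<close>, since
  the added square is almost surely positive; nonnegativity for all \<open>n\<close> then follows by
  induction from this same step. The law with zero degrees of freedom sits at 0, hence the
  successor.\<close>

lemma AE_chi_squared_Suc_pos: "AE v in chi_squared (Suc n). 0 < v"
proof -
  have "AE v in chi_squared (Suc n). 0 < v" if "AE v in chi_squared n. 0 \<le> v" for n
  proof -
    interpret pair_sigma_finite "chi_squared n" std_normal_distribution
      by (rule pair_sigma_finite_chi_squared)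
    have "AE v in chi_squared n. AE b in std_normal_distribution. 0 < v + b\<^sup>2"
      using that
    proof eventually_elim
      case (elim v)
      show ?case
        using AE_std_normal_neq[of 0] by eventually_elim (use elim in \<open>simp add: add_nonneg_pos\<close>)
    qed
    then have "AE z in chi_squared n \<Otimes>\<^sub>M std_normal_distribution. 0 < fst z + (snd z)\<^sup>2"
      by (intro AE_pair_measure[rotated]) (simp, measurable)
    then show ?thesis
      by (subst chi_squared.simps, subst AE_distr_iff) (auto simp: measurable_chi_squared_step split_beta')
  qed
  moreover have "AE v in chi_squared n. 0 \<le> v" for n
  proof (induction n)
    case 0
    have "AE v in return borel (0::real). 0 \<le> v" by (subst AE_return) auto
    then show ?case by (simp only: chi_squared.simps)
  next
    case (Suc n)
    from calculation[OF this] show ?case by eventually_elim simp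
  qed
  ultimately show ?thesis by blast
qed

text \<open>The exponential factor turns the standard normal kernel into the one of variance 1 / (1
  + l); substituting b / sqrt (1 + l) restores the standard density and leaves the Jacobian in
  front.\<close>

lemma nn_integral_std_normal_exp:
  assumes [measurable]: "f \<in> borel_measurable borel" and l: "0 \<le> l"
  shows "(\<integral>\<^sup>+b. f b * ennreal (exp (- l * b\<^sup>2 / 2)) \<partial>std_normal_distribution)
    = ennreal (1 / sqrt (1 + l)) * (\<integral>\<^sup>+b. f (b / sqrt (1 + l)) \<partial>std_normal_distribution)"
proof -
  have r: "0 < sqrt (1 + l)" using l by simp
  have e: "ennreal (std_normal_density (b / sqrt (1 + l))) * ennreal (exp (- l * (b / sqrt (1 + l))\<^sup>2 / 2))
      = ennreal (std_normal_density b)" for b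
  proof -
    have "- (b / sqrt (1 + l))\<^sup>2 / 2 + - l * (b / sqrt (1 + l))\<^sup>2 / 2
        = - ((1 + l) * (b / sqrt (1 + l))\<^sup>2) / 2"
      by (simp add: algebra_simps add_divide_distrib)
    also have "\<dots> = - b\<^sup>2 / 2"
      using l by (simp add: power_divide)
    finally show ?thesis
      by (simp add: std_normal_density_def flip: ennreal_mult exp_add)
  qed
  have "(\<integral>\<^sup>+b. f b * ennreal (exp (- l * b\<^sup>2 / 2)) \<partial>std_normal_distribution)
      = (\<integral>\<^sup>+b. ennreal (std_normal_density b) * ennreal (exp (- l * b\<^sup>2 / 2)) * f b \<partial>lborel)"
    by (simp add: nn_integral_density mult_ac)
  also have "\<dots> = ennreal (1 / sqrt (1 + l)) * (\<integral>\<^sup>+b. ennreal (std_normal_density b) * f (b / sqrt (1 + l)) \<partial>lborel)"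
    using r e by (subst nn_integral_real_affine[where c = "1 / sqrt (1 + l)" and t = 0]) simp_all
  finally show ?thesis by (simp add: nn_integral_density)
qed

text \<open>Each of the n independent squares contributes one factor from the one-dimensional tilt,
  and all of them shrink by the same 1 + l, so the tilted law is a rescaled chi-squared law. With l
  = t^2 / \<nu> this produces the shape of the Student density.\<close>

lemma nn_integral_chi_squared_exp:
  assumes "f \<in> borel_measurable borel" and l: "0 \<le> l"
  shows "(\<integral>\<^sup>+v. f v * ennreal (exp (- l * v / 2)) \<partial>chi_squared n)
    = ennreal ((1 / sqrt (1 + l)) ^ n) * (\<integral>\<^sup>+v. f (v / (1 + l)) \<partial>chi_squared n)"
  using assms(1)
proof (induction n arbitrary: f)
  case 0
  then show ?case by (simp add: nn_integral_return)
next
  case (Suc n)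
  note [measurable] = Suc.prems
  interpret N: prob_space std_normal_distribution by (rule prob_space_std_normal)
  let ?k = "1 / sqrt (1 + l)"
  have "(\<integral>\<^sup>+v. f v * ennreal (exp (- l * v / 2)) \<partial>chi_squared (Suc n))
      = (\<integral>\<^sup>+v. \<integral>\<^sup>+b. f (v + b\<^sup>2) * ennreal (exp (- l * (v + b\<^sup>2) / 2)) \<partial>std_normal_distribution \<partial>chi_squared n)"
    by (subst nn_integral_chi_squared_Suc) simp_all
  also have "\<dots> = (\<integral>\<^sup>+v. (\<integral>\<^sup>+b. f (v + b\<^sup>2) * ennreal (exp (- l * b\<^sup>2 / 2)) \<partial>std_normal_distribution)
      * ennreal (exp (- l * v / 2)) \<partial>chi_squared n)"
  proof (rule nn_integral_cong)
    fix v
    have "ennreal (exp (- l * (v + b\<^sup>2) / 2)) = ennreal (exp (- l * b\<^sup>2 / 2)) * ennreal (exp (- l * v / 2))" for b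
      by (simp flip: ennreal_mult exp_add add: field_simps)
    then show "(\<integral>\<^sup>+b. f (v + b\<^sup>2) * ennreal (exp (- l * (v + b\<^sup>2) / 2)) \<partial>std_normal_distribution)
        = (\<integral>\<^sup>+b. f (v + b\<^sup>2) * ennreal (exp (- l * b\<^sup>2 / 2)) \<partial>std_normal_distribution)
          * ennreal (exp (- l * v / 2))"
      by (simp add: nn_integral_multc flip: mult.assoc)
  qed
  also have "\<dots> = (\<integral>\<^sup>+v. ennreal ?k * (\<integral>\<^sup>+b. f (v + b\<^sup>2 / (1 + l)) \<partial>std_normal_distribution)
      * ennreal (exp (- l * v / 2)) \<partial>chi_squared n)"
    using l by (subst nn_integral_std_normal_exp[of "\<lambda>b. f (_ + b\<^sup>2)"]) (simp_all add: power_divide)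
  also have "\<dots> = ennreal (?k ^ n) *
      (\<integral>\<^sup>+v. ennreal ?k * (\<integral>\<^sup>+b. f (v / (1 + l) + b\<^sup>2 / (1 + l)) \<partial>std_normal_distribution) \<partial>chi_squared n)"
    by (rule Suc.IH) measurable
  also have "\<dots> = ennreal (?k ^ Suc n) * (\<integral>\<^sup>+v. f (v / (1 + l)) \<partial>chi_squared (Suc n))"
  proof -
    have "ennreal (?k ^ Suc n) = ennreal ?k * ennreal (?k ^ n)"
      using l by (simp flip: ennreal_mult)
    then show ?thesis
      by (subst nn_integral_chi_squared_Suc) (simp_all add: nn_integral_cmult add_divide_distrib mult_ac)
  qed
  finally show ?case .
qed

section \<open>Joint law of the mean and the sum of squares of a normal sample\<close>

definition split_ssq :: "nat \<Rightarrow> (nat \<Rightarrow> real) \<Rightarrow> real" where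
  "split_ssq n x = (\<Sum>q\<in>{1..n}. (x q - split_mean n x)\<^sup>2)"

lemma split_t_eq: "split_t Q x = sqrt (real Q) * split_mean Q x / sqrt (split_ssq Q x / (real Q - 1))"
  by (simp add: split_t_def split_ssq_def)

lemma split_ssq_eq: "0 < n \<Longrightarrow> split_ssq n x = (\<Sum>q\<in>{1..n}. (x q)\<^sup>2) - (\<Sum>q\<in>{1..n}. x q)\<^sup>2 / real n"
proof -
  assume n: "0 < n"
  define m where "m = split_mean n x"
  have m: "(\<Sum>q\<in>{1..n}. x q) = real n * m" using n by (simp add: m_def split_mean_def)
  have "split_ssq n x = (\<Sum>q\<in>{1..n}. (x q)\<^sup>2 - 2 * m * x q + m\<^sup>2)"
    by (simp add: split_ssq_def m_def power2_diff algebra_simps)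
  also have "\<dots> = (\<Sum>q\<in>{1..n}. (x q)\<^sup>2) - 2 * m * (\<Sum>q\<in>{1..n}. x q) + real n * m\<^sup>2"
    by (simp add: sum.distrib sum_subtractf sum_distrib_left)
  also have "\<dots> = (\<Sum>q\<in>{1..n}. (x q)\<^sup>2) - (\<Sum>q\<in>{1..n}. x q)\<^sup>2 / real n"
    using n unfolding m by (simp add: power2_eq_square)
  finally show ?thesis .
qed

text \<open>Welford's update of the mean and the sum of squared deviations is a reflection.\<close>

lemma split_mean_update:
  assumes n: "0 < n"
    and c_def: "c = sqrt (real n) / sqrt (real n + 1)" and s_def: "s = 1 / sqrt (real n + 1)"
  shows "sqrt (real (Suc n)) * split_mean (Suc n) (x(Suc n := y))
           = c * (sqrt (real n) * split_mean n x) + s * y" (is ?mean)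
    and "split_ssq (Suc n) (x(Suc n := y))
           = split_ssq n x + (s * (sqrt (real n) * split_mean n x) - c * y)\<^sup>2" (is ?ssq)
proof -
  let ?S = "\<Sum>q\<in>{1..n}. x q"
  have sqrt_div: "sqrt r * (t / r) = t / sqrt r" if "0 < r" for r t :: real
  proof -
    have "sqrt r * (t / r) = t * (sqrt r / r)" by simp
    also have "sqrt r / r = 1 / sqrt r" using that by (simp add: sqrt_divide_self_eq inverse_eq_divide)
    finally show ?thesis by simp
  qed
  have S: "(\<Sum>q\<in>{1..Suc n}. (x(Suc n := y)) q) = ?S + y"
    "(\<Sum>q\<in>{1..Suc n}. ((x(Suc n := y)) q)\<^sup>2) = (\<Sum>q\<in>{1..n}. (x q)\<^sup>2) + y\<^sup>2"
    by simp_all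
  have "sqrt (real (Suc n)) * split_mean (Suc n) (x(Suc n := y)) = (?S + y) / sqrt (real n + 1)"
    unfolding split_mean_def S by (subst sqrt_div) (simp_all add: add.commute)
  moreover have A: "sqrt (real n) * split_mean n x = ?S / sqrt (real n)"
    using n by (simp only: split_mean_def sqrt_div of_nat_0_less_iff)
  then have "c * (sqrt (real n) * split_mean n x) = ?S / sqrt (real n + 1)"
    using n by (simp add: c_def)
  ultimately show ?mean by (simp add: distrib_left s_def add_divide_distrib)
  from A have "s * (sqrt (real n) * split_mean n x) - c * y
      = (?S / sqrt (real n) - sqrt (real n) * y) / sqrt (real n + 1)"
    by (simp add: s_def c_def diff_divide_distrib)
  then have "(s * (sqrt (real n) * split_mean n x) - c * y)\<^sup>2
      = (?S\<^sup>2 / real n - 2 * ?S * y + real n * y\<^sup>2) / (real n + 1)"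
    using n by (simp add: power_divide power2_diff power_mult_distrib)
  then show ?ssq
    using n unfolding split_ssq_eq[OF n] split_ssq_eq[OF zero_less_Suc] S
    by (simp add: divide_simps) (simp add: power2_eq_square algebra_simps)
qed

lemma measurable_split_mean [measurable]:
  "split_mean n \<in> borel_measurable (PiM {1..n} (\<lambda>_. borel))"
  unfolding split_mean_def by measurable

lemma measurable_split_ssq [measurable]:
  "split_ssq n \<in> borel_measurable (PiM {1..n} (\<lambda>_. borel))"
  unfolding split_ssq_def by measurable

lemma measurable_split_t [measurable]:
  "split_t n \<in> borel_measurable (PiM {1..n} (\<lambda>_. borel))"
  unfolding split_t_eq by measurable

abbreviation std_normal_sample :: "nat \<Rightarrow> (nat \<Rightarrow> real) measure" where
  "std_normal_sample n \<equiv> PiM {1..n} (\<lambda>_. std_normal_distribution)"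

lemma sets_std_normal_sample [measurable_cong]:
  "sets (std_normal_sample n) = sets (PiM {1..n} (\<lambda>_. borel))"
  by (intro sets_PiM_cong) auto

text \<open>Mean and sum of squares are independent because an update acts on three independent
  variables: the scaled mean a, the new observation y and the sum of squares v. The reflection sends
  (a, y) to another pair (a', b) of independent standard normals, and v grows by b^2. The first
  observation leaves v at 0, so v has one degree of freedom less than there are
  observations.\<close>

lemma nn_integral_std_normal_sample:
  assumes "f \<in> borel_measurable (borel \<Otimes>\<^sub>M borel)"
  shows "(\<integral>\<^sup>+x. f (sqrt (real (Suc n)) * split_mean (Suc n) x, split_ssq (Suc n) x)
       \<partial>std_normal_sample (Suc n))
    = (\<integral>\<^sup>+v. \<integral>\<^sup>+a. f (a, v) \<partial>std_normal_distribution \<partial>chi_squared n)"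
  using assms
proof (induction n arbitrary: f)
  case 0
  interpret product_sigma_finite "\<lambda>_::nat. std_normal_distribution"
    by (intro product_sigma_finite.intro prob_space_imp_sigma_finite prob_space_std_normal)
  note [measurable] = 0
  have "split_mean 1 x = x 1" "split_ssq 1 x = 0" for x
    by (simp_all add: split_mean_def split_ssq_def)
  then show ?case
    using product_nn_integral_singleton[of "\<lambda>y. f (y, 0)" 1] by (simp add: nn_integral_return)
next
  case (Suc m)
  define n where "n = Suc m"
  have n: "0 < n" by (simp add: n_def)
  note IH = Suc.IH[folded n_def]
  interpret product_sigma_finite "\<lambda>_::nat. std_normal_distribution"
    by (intro product_sigma_finite.intro prob_space_imp_sigma_finite prob_space_std_normal)
  interpret pair_sigma_finite std_normal_distribution std_normal_distribution
    by (rule pair_sigma_finite_std_normal)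
  note [measurable] = Suc.prems
  define c s where "c = sqrt (real n) / sqrt (real n + 1)" and "s = 1 / sqrt (real n + 1)"
  have cs: "c\<^sup>2 + s\<^sup>2 = 1"
    by (simp add: c_def s_def power_divide flip: add_divide_distrib)
  have insert: "{1..Suc n} = insert (Suc n) {1..n}" and not_in: "Suc n \<notin> {1..n}" by auto
  have "(\<integral>\<^sup>+x. f (sqrt (real (Suc n)) * split_mean (Suc n) x, split_ssq (Suc n) x) \<partial>std_normal_sample (Suc n))
      = (\<integral>\<^sup>+x. \<integral>\<^sup>+y. f (c * (sqrt (real n) * split_mean n x) + s * y,
            split_ssq n x + (s * (sqrt (real n) * split_mean n x) - c * y)\<^sup>2)
          \<partial>std_normal_distribution \<partial>std_normal_sample n)"
  proof -
    have "(\<lambda>x. f (sqrt (real (Suc n)) * split_mean (Suc n) x, split_ssq (Suc n) x))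
        \<in> borel_measurable (std_normal_sample (Suc n))" by measurable
    then show ?thesis
      unfolding insert by (subst product_nn_integral_insert)
        (simp_all only: split_mean_update[OF n c_def s_def] finite_atLeastAtMost not_in not_False_eq_True)
  qed
  also have "\<dots> = (\<integral>\<^sup>+v. \<integral>\<^sup>+a. \<integral>\<^sup>+y. f (c * a + s * y, v + (s * a - c * y)\<^sup>2)
          \<partial>std_normal_distribution \<partial>std_normal_distribution \<partial>chi_squared m)"
    using IH[of "\<lambda>(a, v). \<integral>\<^sup>+y. f (c * a + s * y, v + (s * a - c * y)\<^sup>2) \<partial>std_normal_distribution"]
    by simp
  also have "\<dots> = (\<integral>\<^sup>+v. \<integral>\<^sup>+a. \<integral>\<^sup>+b. f (a, v + b\<^sup>2)
          \<partial>std_normal_distribution \<partial>std_normal_distribution \<partial>chi_squared m)"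
    using std_normal_reflection[OF _ cs, of "\<lambda>(a, b). f (a, _ + b\<^sup>2)"] by simp
  \<comment> \<open>Fubini moves the integral over b next to the one over v, so that v + b^2 can be
    absorbed into \<open>chi_squared (Suc m)\<close>.\<close>
  also have "\<dots> = (\<integral>\<^sup>+v. \<integral>\<^sup>+b. \<integral>\<^sup>+a. f (a, v + b\<^sup>2)
          \<partial>std_normal_distribution \<partial>std_normal_distribution \<partial>chi_squared m)"
    by (intro nn_integral_cong Fubini'[symmetric]) measurable
  also have "\<dots> = (\<integral>\<^sup>+v. \<integral>\<^sup>+a. f (a, v) \<partial>std_normal_distribution \<partial>chi_squared (Suc m))"
    by (subst nn_integral_chi_squared_Suc) simp_all
  finally show ?case by (simp only: n_def)
qed

section \<open>The Student kernel and the law of the t-statistic\<close>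

lemma nn_integral_Gamma_scaled:
  assumes s: "0 < s" and A: "0 < A"
  shows "(\<integral>\<^sup>+v. ennreal (indicator {0..} v * v powr (s - 1) * exp (- A * v)) \<partial>lborel)
    = ennreal (Gamma s * A powr (- s))"
proof -
  have "ennreal (Gamma s) = (\<integral>\<^sup>+t. ennreal (indicator {0..} t * t powr (s - 1) / exp t) \<partial>lborel)"
    by (rule Gamma_conv_nn_integral_real[OF s])
  also have "\<dots> = ennreal A *
      (\<integral>\<^sup>+v. ennreal (indicator {0..} (A * v) * (A * v) powr (s - 1) / exp (A * v)) \<partial>lborel)"
    using A by (subst nn_integral_real_affine[where c = A and t = 0]) simp_all
  also have "(\<lambda>v. ennreal (indicator {0..} (A * v) * (A * v) powr (s - 1) / exp (A * v)))
      = (\<lambda>v. ennreal (A powr (s - 1)) * ennreal (indicator {0..} v * v powr (s - 1) * exp (- A * v)))"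
    using A by (auto simp: fun_eq_iff indicator_def zero_le_mult_iff powr_mult exp_minus divide_inverse
        simp flip: ennreal_mult)
  also have "ennreal A * (\<integral>\<^sup>+v. ennreal (A powr (s - 1)) *
        ennreal (indicator {0..} v * v powr (s - 1) * exp (- A * v)) \<partial>lborel)
      = ennreal (A powr s) * (\<integral>\<^sup>+v. ennreal (indicator {0..} v * v powr (s - 1) * exp (- A * v)) \<partial>lborel)"
  proof -
    have "A * A powr (s - 1) = A powr s" using A by (simp add: powr_mult_base)
    then show ?thesis
      using A by (subst nn_integral_cmult, simp) (simp flip: mult.assoc ennreal_mult)
  qed
  finally have "ennreal (A powr (- s)) * ennreal (Gamma s) = ennreal (A powr (- s)) * (ennreal (A powr s) *
      (\<integral>\<^sup>+v. ennreal (indicator {0..} v * v powr (s - 1) * exp (- A * v)) \<partial>lborel))"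
    by simp
  moreover have "ennreal (A powr (- s)) * ennreal (A powr s) = 1"
    using A by (simp flip: ennreal_mult powr_add)
  moreover have "ennreal (A powr (- s)) * ennreal (Gamma s) = ennreal (Gamma s * A powr (- s))"
    by (simp add: ennreal_mult'' mult.commute)
  ultimately show ?thesis by (simp only: mult.assoc[symmetric] mult_1)
qed

text \<open>Read off from the total mass of the normal density with variance 1 / (2 a).\<close>

lemma nn_integral_gaussian:
  assumes a: "0 < a"
  shows "(\<integral>\<^sup>+t. ennreal (exp (- a * t\<^sup>2)) \<partial>lborel) = ennreal (sqrt (pi / a))"
proof -
  define \<sigma> where "\<sigma> = sqrt (1 / (2 * a))"
  have \<sigma>: "0 < \<sigma>" "\<sigma>\<^sup>2 = 1 / (2 * a)" using a by (simp_all add: \<sigma>_def)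
  interpret prob_space "density lborel (normal_density 0 \<sigma>)"
    by (rule prob_space_normal_density) fact
  have "normal_density 0 \<sigma> t = 1 / sqrt (pi / a) * exp (- a * t\<^sup>2)" for t
    using a by (simp add: normal_density_def \<sigma>)
  then have "(\<integral>\<^sup>+t. ennreal (1 / sqrt (pi / a)) * ennreal (exp (- a * t\<^sup>2)) \<partial>lborel) = 1"
    using emeasure_space_1 a by (simp add: emeasure_density flip: ennreal_mult)
  then have "ennreal (sqrt (pi / a)) * (ennreal (1 / sqrt (pi / a)) * (\<integral>\<^sup>+t. ennreal (exp (- a * t\<^sup>2)) \<partial>lborel))
      = ennreal (sqrt (pi / a))"
    by (simp add: nn_integral_cmult)
  then show ?thesis
    using a by (simp flip: mult.assoc ennreal_mult)
qed

text \<open>The Gamma integral writes the power as a mixture of exponentials in v. After exchanging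
  the integrals, the one over t is Gaussian and contributes v powr (-1/2), which lowers the Gamma
  parameter from (\<nu> + 1) / 2 to \<nu> / 2.\<close>

lemma nn_integral_student_kernel:
  assumes \<nu>: "0 < \<nu>"
  shows "(\<integral>\<^sup>+t. ennreal ((1 + t\<^sup>2 / \<nu>) powr (- (\<nu> + 1) / 2)) \<partial>lborel)
    = ennreal (sqrt (\<nu> * pi) * Gamma (\<nu> / 2) / Gamma ((\<nu> + 1) / 2))"
proof -
  define s where "s = (\<nu> + 1) / 2"
  have s: "0 < s" "0 < s - 1 / 2" "- (\<nu> + 1) / 2 = - s" "\<nu> / 2 = s - 1 / 2"
    using \<nu> by (simp_all add: s_def field_simps)
  have A: "0 < 1 + t\<^sup>2 / \<nu>" for t using \<nu> by (simp add: add_pos_nonneg)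
  have G: "0 < Gamma s" using s by (rule_tac Gamma_real_pos)
  have "ennreal (Gamma s) * (\<integral>\<^sup>+t. ennreal ((1 + t\<^sup>2 / \<nu>) powr (- s)) \<partial>lborel)
      = (\<integral>\<^sup>+t. ennreal (Gamma s * (1 + t\<^sup>2 / \<nu>) powr (- s)) \<partial>lborel)"
    using G by (simp add: nn_integral_cmult ennreal_mult)
  also have "\<dots> = (\<integral>\<^sup>+t. \<integral>\<^sup>+v. ennreal (indicator {0..} v * v powr (s - 1) * exp (- (1 + t\<^sup>2 / \<nu>) * v)) \<partial>lborel \<partial>lborel)"
    by (subst nn_integral_Gamma_scaled[OF s(1) A]) simp
  also have "\<dots> = (\<integral>\<^sup>+v. \<integral>\<^sup>+t. ennreal (indicator {0..} v * v powr (s - 1) * exp (- (1 + t\<^sup>2 / \<nu>) * v)) \<partial>lborel \<partial>lborel)"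
    by (rule lborel_pair.Fubini'[symmetric]) simp
  also have "\<dots> = (\<integral>\<^sup>+v. ennreal (sqrt (\<nu> * pi)) *
      ennreal (indicator {0..} v * v powr (s - 1 / 2 - 1) * exp (- 1 * v)) \<partial>lborel)"
  proof (rule nn_integral_cong_AE, use AE_lborel_singleton[of "0::real"] in eventually_elim)
    case (elim v)
    show ?case
    proof (cases "0 < v")
      case True
      have "(\<integral>\<^sup>+t. ennreal (indicator {0..} v * v powr (s - 1) * exp (- (1 + t\<^sup>2 / \<nu>) * v)) \<partial>lborel)
          = (\<integral>\<^sup>+t. ennreal (v powr (s - 1) * exp (- v)) * ennreal (exp (- (v / \<nu>) * t\<^sup>2)) \<partial>lborel)"
        using True by (intro nn_integral_cong)
          (simp add: ring_distribs mult.commute flip: ennreal_mult exp_add)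
      also have "\<dots> = ennreal (v powr (s - 1) * exp (- v)) * ennreal (sqrt (pi / (v / \<nu>)))"
        using True \<nu> by (subst nn_integral_cmult, simp, subst nn_integral_gaussian) simp_all
      also have "sqrt (pi / (v / \<nu>)) = sqrt (\<nu> * pi) * v powr - (1 / 2)"
      proof -
        have "sqrt (pi / (v / \<nu>)) = sqrt (\<nu> * pi / v)" by (simp add: mult.commute)
        also have "\<dots> = sqrt (\<nu> * pi) * v powr - (1 / 2)"
          using True unfolding powr_minus_divide by (simp add: powr_half_sqrt real_sqrt_divide)
        finally show ?thesis .
      qed
      also have "ennreal (v powr (s - 1) * exp (- v)) * ennreal (sqrt (\<nu> * pi) * v powr - (1 / 2))
          = ennreal (sqrt (\<nu> * pi) * ((v powr (s - 1) * v powr - (1 / 2)) * exp (- v)))"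
        using \<nu> by (simp add: mult_ac flip: ennreal_mult)
      also have "v powr (s - 1) * v powr - (1 / 2) = v powr (s - 1 / 2 - 1)"
        unfolding powr_add[symmetric] by (rule arg_cong) simp
      finally show ?thesis using True \<nu> by (simp add: ennreal_mult)
    qed (use elim in simp)
  qed
  also have "\<dots> = ennreal (sqrt (\<nu> * pi)) * ennreal (Gamma (s - 1 / 2))"
    using nn_integral_Gamma_scaled[OF s(2), of 1] by (simp add: nn_integral_cmult)
  finally have "ennreal (1 / Gamma s) * (ennreal (Gamma s) * (\<integral>\<^sup>+t. ennreal ((1 + t\<^sup>2 / \<nu>) powr (- s)) \<partial>lborel))
      = ennreal (1 / Gamma s) * (ennreal (sqrt (\<nu> * pi)) * ennreal (Gamma (s - 1 / 2)))"
    by simp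
  then show ?thesis
    using G \<nu> s Gamma_real_pos[of "s - 1 / 2"]
    unfolding s(3,4) s_def[symmetric] by (simp flip: mult.assoc ennreal_mult)
qed

text \<open>The law of \<open>a / sqrt (v / n)\<close> is a multiple of the Student kernel by scaling alone; the constant
  is then determined by the total mass.\<close>

lemma nn_integral_student_t:
  assumes n: "0 < n" and [measurable]: "f \<in> borel_measurable borel"
  shows "(\<integral>\<^sup>+v. \<integral>\<^sup>+a. f (a / sqrt (v / real n)) \<partial>std_normal_distribution \<partial>chi_squared n)
    = (\<integral>\<^sup>+t. f t \<partial>student_t (real n))"
proof -
  define \<nu> where "\<nu> = real n"
  have \<nu>: "0 < \<nu>" using n by (simp add: \<nu>_def)
  interpret C: prob_space "chi_squared n" by (rule prob_space_chi_squared)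
  interpret N: prob_space std_normal_distribution by (rule prob_space_std_normal)
  interpret CL: pair_sigma_finite "chi_squared n" "lborel :: real measure" by unfold_locales
  define k where "k t = (1 + t\<^sup>2 / \<nu>) powr (- (\<nu> + 1) / 2)" for t :: real
  \<comment> \<open>C contains the mean of sqrt v, which is never computed: comparing total masses
    gives the value of C at the end.\<close>
  define C where "C = ennreal (1 / sqrt (2 * pi * \<nu>)) * (\<integral>\<^sup>+v. ennreal (sqrt v) \<partial>chi_squared n)"
  have [measurable]: "k \<in> borel_measurable borel" unfolding k_def by measurable
  have pos: "AE v in chi_squared n. 0 < v"
    using n AE_chi_squared_Suc_pos by (cases n) (simp, simp only:)
  \<comment> \<open>The substitution a = sqrt (v / \<nu>) * t leads to this integrand, whose
    exponential is the tilt with l = t^2 / \<nu>. The tilt yields n factors 1 / sqrt (1 + l) and the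
    rescaled sqrt v one more; these n + 1 factors make up the exponent -(\<nu> + 1) / 2 of
    \<open>k\<close>.\<close>
  have inner: "(\<integral>\<^sup>+v. ennreal (sqrt (v / \<nu>) * std_normal_density (sqrt (v / \<nu>) * t)) \<partial>chi_squared n)
      = C * ennreal (k t)" for t
  proof -
    have A: "0 < 1 + t\<^sup>2 / \<nu>" using \<nu> by (simp add: add_pos_nonneg)
    have "(\<integral>\<^sup>+v. ennreal (sqrt (v / \<nu>) * std_normal_density (sqrt (v / \<nu>) * t)) \<partial>chi_squared n)
        = (\<integral>\<^sup>+v. ennreal (1 / sqrt (2 * pi * \<nu>)) *
            (ennreal (sqrt v) * ennreal (exp (- (t\<^sup>2 / \<nu>) * v / 2))) \<partial>chi_squared n)"
      by (rule nn_integral_cong_AE, use pos in eventually_elim)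
         (use \<nu> in \<open>simp add: std_normal_density_def real_sqrt_divide real_sqrt_mult power_mult_distrib
            power_divide mult_ac flip: ennreal_mult\<close>)
    also have "\<dots> = ennreal (1 / sqrt (2 * pi * \<nu>)) * (ennreal ((1 / sqrt (1 + t\<^sup>2 / \<nu>)) ^ n)
        * (\<integral>\<^sup>+v. ennreal (sqrt (v / (1 + t\<^sup>2 / \<nu>))) \<partial>chi_squared n))"
      using \<nu> by (subst nn_integral_cmult, simp, subst nn_integral_chi_squared_exp) simp_all
    also have "(\<integral>\<^sup>+v. ennreal (sqrt (v / (1 + t\<^sup>2 / \<nu>))) \<partial>chi_squared n)
        = (\<integral>\<^sup>+v. ennreal (1 / sqrt (1 + t\<^sup>2 / \<nu>)) * ennreal (sqrt v) \<partial>chi_squared n)"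
      by (rule nn_integral_cong_AE, use pos in eventually_elim)
         (use A in \<open>simp add: real_sqrt_divide flip: ennreal_mult\<close>)
    also have "\<dots> = ennreal (1 / sqrt (1 + t\<^sup>2 / \<nu>)) * (\<integral>\<^sup>+v. ennreal (sqrt v) \<partial>chi_squared n)"
      by (rule nn_integral_cmult) simp
    also have "ennreal (1 / sqrt (2 * pi * \<nu>)) * (ennreal ((1 / sqrt (1 + t\<^sup>2 / \<nu>)) ^ n)
        * (ennreal (1 / sqrt (1 + t\<^sup>2 / \<nu>)) * (\<integral>\<^sup>+v. ennreal (sqrt v) \<partial>chi_squared n)))
        = C * (ennreal ((1 / sqrt (1 + t\<^sup>2 / \<nu>)) ^ n) * ennreal (1 / sqrt (1 + t\<^sup>2 / \<nu>)))"
      by (simp add: C_def mult_ac)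
    also have "ennreal ((1 / sqrt (1 + t\<^sup>2 / \<nu>)) ^ n) * ennreal (1 / sqrt (1 + t\<^sup>2 / \<nu>))
        = ennreal ((1 / sqrt (1 + t\<^sup>2 / \<nu>)) ^ Suc n)"
      using A by (simp add: mult.commute flip: ennreal_mult)
    also have "(1 / sqrt (1 + t\<^sup>2 / \<nu>)) ^ Suc n = k t"
    proof -
      have "1 / sqrt (1 + t\<^sup>2 / \<nu>) = (1 + t\<^sup>2 / \<nu>) powr - (1 / 2)"
        using A unfolding powr_minus_divide by (simp add: powr_half_sqrt)
      then have "(1 / sqrt (1 + t\<^sup>2 / \<nu>)) ^ Suc n = ((1 + t\<^sup>2 / \<nu>) powr - (1 / 2)) ^ Suc n"
        by simp
      also have "\<dots> = (1 + t\<^sup>2 / \<nu>) powr (real (Suc n) * - (1 / 2))"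
        by (rule powr_power) (use A in simp)
      also have "real (Suc n) * - (1 / 2) = - (\<nu> + 1) / 2"
        by (simp add: \<nu>_def field_simps)
      finally show ?thesis by (simp add: k_def)
    qed
    finally show ?thesis .
  qed
  have main: "(\<integral>\<^sup>+v. \<integral>\<^sup>+a. g (a / sqrt (v / \<nu>)) \<partial>std_normal_distribution \<partial>chi_squared n)
      = C * (\<integral>\<^sup>+t. g t * ennreal (k t) \<partial>lborel)"
    if [measurable]: "g \<in> borel_measurable borel" for g
  proof -
    have "(\<integral>\<^sup>+v. \<integral>\<^sup>+a. g (a / sqrt (v / \<nu>)) \<partial>std_normal_distribution \<partial>chi_squared n)
        = (\<integral>\<^sup>+v. \<integral>\<^sup>+t. g t * ennreal (sqrt (v / \<nu>) * std_normal_density (sqrt (v / \<nu>) * t)) \<partial>lborel \<partial>chi_squared n)"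
    proof (rule nn_integral_cong_AE, use pos in eventually_elim)
      case (elim v)
      define r where "r = sqrt (v / \<nu>)"
      have r: "0 < r" using elim \<nu> by (simp add: r_def)
      have "(\<integral>\<^sup>+a. g (a / r) \<partial>std_normal_distribution)
          = (\<integral>\<^sup>+a. ennreal (std_normal_density a) * g (a / r) \<partial>lborel)"
        by (simp add: nn_integral_density)
      also have "\<dots> = (\<integral>\<^sup>+t. ennreal r * (ennreal (std_normal_density (r * t)) * g t) \<partial>lborel)"
        using r by (subst nn_integral_real_affine[where c = r and t = 0]) (simp_all add: nn_integral_cmult)
      finally show ?case
        using r unfolding r_def[symmetric] by (simp add: ennreal_mult mult_ac)
    qed
    also have "\<dots> = (\<integral>\<^sup>+t. \<integral>\<^sup>+v. g t * ennreal (sqrt (v / \<nu>) * std_normal_density (sqrt (v / \<nu>) * t)) \<partial>chi_squared n \<partial>lborel)"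
      by (rule CL.Fubini'[symmetric]) simp
    also have "\<dots> = (\<integral>\<^sup>+t. g t * (C * ennreal (k t)) \<partial>lborel)"
      by (simp add: nn_integral_cmult inner)
    also have "\<dots> = C * (\<integral>\<^sup>+t. g t * ennreal (k t) \<partial>lborel)"
      by (simp add: nn_integral_cmult mult.left_commute)
    finally show ?thesis .
  qed
  define J where "J = sqrt (\<nu> * pi) * Gamma (\<nu> / 2) / Gamma ((\<nu> + 1) / 2)"
  have J: "0 < J" using \<nu> by (simp add: J_def Gamma_real_pos)
  \<comment> \<open>The test function 1 gives total mass one on the left and the kernel integral J
    on the right; J is positive and finite, so C = 1 / J.\<close>
  have "1 = C * ennreal J"
    using main[of "\<lambda>_. 1"] nn_integral_student_kernel[OF \<nu>]
    by (simp add: k_def J_def N.emeasure_space_1[simplified] C.emeasure_space_1[simplified])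
  then have "ennreal (1 / J) = C * (ennreal J * ennreal (1 / J))"
    by (simp flip: mult.assoc)
  then have C: "C = ennreal (1 / J)"
    using J by (simp flip: ennreal_mult)
  have "student_t_density \<nu> t = 1 / J * k t" for t
    by (simp add: student_t_density_def J_def k_def)
  then have dens: "ennreal (student_t_density \<nu> t) = C * ennreal (k t)" for t
    using J by (simp only: C) (simp add: k_def flip: ennreal_mult)
  have [measurable]: "student_t_density \<nu> \<in> borel_measurable borel"
    unfolding student_t_density_def by measurable
  have "(\<integral>\<^sup>+t. f t \<partial>student_t \<nu>) = (\<integral>\<^sup>+t. C * (f t * ennreal (k t)) \<partial>lborel)"
    unfolding student_t_def by (subst nn_integral_density) (simp_all add: dens mult_ac)
  then show ?thesis
    using main[of f] by (simp add: nn_integral_cmult \<nu>_def)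
qed

lemma distr_split_t_std_normal:
  assumes Q: "2 \<le> Q"
  shows "distr (std_normal_sample Q) borel (split_t Q) = student_t (real Q - 1)"
proof (rule measure_eqI)
  fix B assume "B \<in> sets (distr (std_normal_sample Q) borel (split_t Q))"
  then have [measurable]: "B \<in> sets borel" by simp
  obtain n where n: "Q = Suc n" "0 < n" using Q by (cases Q) auto
  have "emeasure (distr (std_normal_sample Q) borel (split_t Q)) B
      = (\<integral>\<^sup>+x. indicator B x \<partial>distr (std_normal_sample Q) borel (split_t Q))"
    by simp
  also have "\<dots> = (\<integral>\<^sup>+x. indicator B (split_t Q x) \<partial>std_normal_sample Q)"
    by (rule nn_integral_distr) measurable
  also have "\<dots> = (\<integral>\<^sup>+v. \<integral>\<^sup>+a. indicator B (a / sqrt (v / real n)) \<partial>std_normal_distribution \<partial>chi_squared n)"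
    using nn_integral_std_normal_sample[of "\<lambda>(a, v). indicator B (a / sqrt (v / real n))" n]
    by (simp add: split_t_eq n)
  also have "\<dots> = emeasure (student_t (real Q - 1)) B"
    by (subst nn_integral_student_t) (simp_all add: n student_t_def)
  finally show "emeasure (distr (std_normal_sample Q) borel (split_t Q)) B
      = emeasure (student_t (real Q - 1)) B" .
qed (simp add: student_t_def)

text \<open>Continuity of \<open>split_t\<close> breaks down where the sum of squares is 0, so this
  set has to be null under the limit law. \<open>Q \<ge> 2\<close> leaves at least one degree of
  freedom, and \<open>AE_chi_squared_Suc_pos\<close> applies.\<close>

lemma AE_std_normal_sample_ssq:
  assumes Q: "2 \<le> Q"
  shows "AE x in std_normal_sample Q. 0 < split_ssq Q x"
proof -
  obtain n where n: "Q = Suc (Suc n)" using Q by (metis add_2_eq_Suc le_Suc_ex)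
  interpret N: prob_space std_normal_distribution by (rule prob_space_std_normal)
  have "(\<integral>\<^sup>+x. indicator {..0} (split_ssq Q x) \<partial>std_normal_sample Q)
      = (\<integral>\<^sup>+v. \<integral>\<^sup>+a. indicator {..0} v \<partial>std_normal_distribution \<partial>chi_squared (Suc n))"
    unfolding n
    using nn_integral_std_normal_sample[of "\<lambda>(a, v). indicator {..0} v" "Suc n"] by simp
  also have "\<dots> = (\<integral>\<^sup>+v. indicator {..0} v \<partial>chi_squared (Suc n))"
    by (simp add: N.emeasure_space_1[simplified])
  also have "\<dots> = 0"
  proof -
    have "AE v in chi_squared (Suc n). indicator {..0} v = (0 :: ennreal)"
      using AE_chi_squared_Suc_pos by eventually_elim simp
    then show ?thesis by (subst nn_integral_0_iff_AE) simp_all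
  qed
  finally have eq0: "(\<integral>\<^sup>+x. indicator {..0} (split_ssq Q x) \<partial>std_normal_sample Q) = 0" .
  have "(\<lambda>x. indicator {..0} (split_ssq Q x) :: ennreal) \<in> borel_measurable (std_normal_sample Q)"
    by measurable
  from nn_integral_0_iff_AE[OF this] eq0 have "AE x in std_normal_sample Q. indicator {..0} (split_ssq Q x) = (0 :: ennreal)"
    by blast
  then show ?thesis by eventually_elim (simp add: indicator_def split: if_splits)
qed

section \<open>Convergence in probability\<close>

text \<open>Stated for metric spaces so that several estimators form one convergent tuple, to which
  a function of all of them can be applied at once.\<close>

definition tends_in_prob :: "'a measure \<Rightarrow> (nat \<Rightarrow> 'a \<Rightarrow> 'b::metric_space) \<Rightarrow> 'b \<Rightarrow> bool" where
  "tends_in_prob P X c \<longleftrightarrow>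
     (\<forall>e>0. (\<lambda>m. measure P {\<omega> \<in> space P. dist (X m \<omega>) c > e}) \<longlonglongrightarrow> 0)"

lemma conv_in_prob_iff: "conv_in_prob P X c \<longleftrightarrow> tends_in_prob P X c"
  by (simp add: conv_in_prob_def tends_in_prob_def dist_real_def)

text \<open>Stochastic boundedness, written O_P(1) in statistics.\<close>

definition bounded_in_prob :: "'a measure \<Rightarrow> (nat \<Rightarrow> 'a \<Rightarrow> real) \<Rightarrow> bool" where
  "bounded_in_prob P X \<longleftrightarrow>
     (\<forall>e>0. \<exists>B>0. eventually (\<lambda>m. measure P {\<omega> \<in> space P. \<bar>X m \<omega>\<bar> > B} < e) sequentially)"

lemma tends_in_prob_diff_iff:
  fixes X :: "nat \<Rightarrow> 'a \<Rightarrow> real"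
  shows "tends_in_prob P (\<lambda>m \<omega>. X m \<omega> - c) 0 \<longleftrightarrow> tends_in_prob P X c"
  by (simp add: tends_in_prob_def dist_real_def)

lemma tends_in_prob_cong:
  assumes "eventually (\<lambda>m. \<forall>\<omega>\<in>space P. X m \<omega> = Y m \<omega>) sequentially"
  shows "tends_in_prob P X c \<longleftrightarrow> tends_in_prob P Y c"
proof -
  have "eventually (\<lambda>m. measure P {\<omega> \<in> space P. dist (X m \<omega>) c > e}
      = measure P {\<omega> \<in> space P. dist (Y m \<omega>) c > e}) sequentially" for e
    using assms by eventually_elim (rule arg_cong[where f = "measure P"], auto)
  from tendsto_cong[OF this] show ?thesis by (simp add: tends_in_prob_def)
qed

lemma tends_in_prob_const:
  fixes x :: "nat \<Rightarrow> 'b::metric_space"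
  assumes "x \<longlonglongrightarrow> c"
  shows "tends_in_prob P (\<lambda>m \<omega>. x m) c"
  unfolding tends_in_prob_def
proof (intro allI impI)
  fix e :: real assume "0 < e"
  with assms have "eventually (\<lambda>m. dist (x m) c < e) sequentially" by (rule tendstoD)
  then have "eventually (\<lambda>m. measure P {\<omega> \<in> space P. dist (x m) c > e} = 0) sequentially"
    by eventually_elim (auto simp: not_less)
  then show "(\<lambda>m. measure P {\<omega> \<in> space P. dist (x m) c > e}) \<longlonglongrightarrow> 0"
    by (rule tendsto_eventually)
qed

section \<open>Calculus of sequences that converge or are bounded in probability\<close>

context prob_space
begin

lemma tends_in_prob_bound:
  assumes "\<And>e. 0 < e \<Longrightarrow> eventually (\<lambda>m. measure M {\<omega> \<in> space M. dist (X m \<omega>) c > e} \<le> u e m) sequentially"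
    and "\<And>e. 0 < e \<Longrightarrow> u e \<longlonglongrightarrow> 0"
  shows "tends_in_prob M X c"
  unfolding tends_in_prob_def
proof (intro allI impI)
  fix e :: real assume e: "0 < e"
  show "(\<lambda>m. measure M {\<omega> \<in> space M. dist (X m \<omega>) c > e}) \<longlonglongrightarrow> 0"
    by (rule tendsto_sandwich[OF _ assms(1)[OF e] tendsto_const assms(2)[OF e]]) simp
qed

text \<open>With high probability X m lies near c, whatever g does elsewhere, so continuity at the
  one point c is enough. The functions to which this is applied divide by square roots of variance
  estimates and are singular where an estimate vanishes.\<close>

lemma tends_in_prob_isCont:
  fixes X :: "nat \<Rightarrow> 'a \<Rightarrow> 'b::{metric_space, second_countable_topology}"
  assumes X: "tends_in_prob M X c" and g: "isCont g c"
    and [measurable]: "\<And>m. X m \<in> borel_measurable M"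
  shows "tends_in_prob M (\<lambda>m \<omega>. g (X m \<omega>)) (g c)"
  unfolding tends_in_prob_def
proof (intro allI impI)
  fix e :: real assume "0 < e"
  with g obtain d where d: "0 < d" "\<And>x. dist x c < d \<Longrightarrow> dist (g x) (g c) < e"
    unfolding continuous_at_eps_delta by blast
  have le: "measure M {\<omega> \<in> space M. dist (g (X m \<omega>)) (g c) > e}
      \<le> measure M {\<omega> \<in> space M. dist (X m \<omega>) c > d / 2}" for m
  proof (rule finite_measure_mono)
    show "{\<omega> \<in> space M. dist (g (X m \<omega>)) (g c) > e} \<subseteq> {\<omega> \<in> space M. dist (X m \<omega>) c > d / 2}"
    proof safe
      fix \<omega> assume "dist (g (X m \<omega>)) (g c) > e"
      with d(2)[of "X m \<omega>"] have "\<not> dist (X m \<omega>) c < d" by auto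
      with d(1) show "dist (X m \<omega>) c > d / 2" by simp
    qed
  qed measurable
  have lim: "(\<lambda>m. measure M {\<omega> \<in> space M. dist (X m \<omega>) c > d / 2}) \<longlonglongrightarrow> 0"
    using X d(1) unfolding tends_in_prob_def by (meson half_gt_zero)
  show "(\<lambda>m. measure M {\<omega> \<in> space M. dist (g (X m \<omega>)) (g c) > e}) \<longlonglongrightarrow> 0"
    by (rule tendsto_sandwich[OF _ eventuallyI[OF le] tendsto_const lim]) simp
qed

lemma tends_in_prob_Pair:
  fixes X :: "nat \<Rightarrow> 'a \<Rightarrow> 'b::{metric_space, second_countable_topology}"
    and Y :: "nat \<Rightarrow> 'a \<Rightarrow> 'c::{metric_space, second_countable_topology}"
  assumes X: "tends_in_prob M X a" and Y: "tends_in_prob M Y b"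
    and [measurable]: "\<And>m. X m \<in> borel_measurable M" "\<And>m. Y m \<in> borel_measurable M"
  shows "tends_in_prob M (\<lambda>m \<omega>. (X m \<omega>, Y m \<omega>)) (a, b)"
proof (rule tends_in_prob_bound)
  fix e :: real assume e: "0 < e"
  let ?u = "\<lambda>m. measure M {\<omega> \<in> space M. dist (X m \<omega>) a > e / 2}
      + measure M {\<omega> \<in> space M. dist (Y m \<omega>) b > e / 2}"
  have "measure M {\<omega> \<in> space M. dist (X m \<omega>, Y m \<omega>) (a, b) > e} \<le> ?u m" for m
  proof -
    have "measure M {\<omega> \<in> space M. dist (X m \<omega>, Y m \<omega>) (a, b) > e}
      \<le> measure M ({\<omega> \<in> space M. dist (X m \<omega>) a > e / 2} \<union> {\<omega> \<in> space M. dist (Y m \<omega>) b > e / 2})"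
    proof (rule finite_measure_mono)
      have "dist (X m \<omega>, Y m \<omega>) (a, b) \<le> dist (X m \<omega>) a + dist (Y m \<omega>) b" for \<omega>
        unfolding dist_Pair_Pair by (rule sqrt_sum_squares_le_sum) simp_all
      then have "e / 2 < dist (X m \<omega>) a \<or> e / 2 < dist (Y m \<omega>) b"
        if "e < dist (X m \<omega>, Y m \<omega>) (a, b)" for \<omega>
        using that by (smt (verit) field_sum_of_halves)
      then show "{\<omega> \<in> space M. dist (X m \<omega>, Y m \<omega>) (a, b) > e}
        \<subseteq> {\<omega> \<in> space M. dist (X m \<omega>) a > e / 2} \<union> {\<omega> \<in> space M. dist (Y m \<omega>) b > e / 2}"
        by blast
    qed measurable
    also have "\<dots> \<le> ?u m"
      by (rule measure_Un_le) measurable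
    finally show ?thesis .
  qed
  then show "eventually (\<lambda>m. measure M {\<omega> \<in> space M. dist (X m \<omega>, Y m \<omega>) (a, b) > e} \<le> ?u m) sequentially"
    by simp
  have "(\<lambda>m. measure M {\<omega> \<in> space M. dist (X m \<omega>) a > e / 2}) \<longlonglongrightarrow> 0"
    using X e unfolding tends_in_prob_def by (meson half_gt_zero)
  moreover have "(\<lambda>m. measure M {\<omega> \<in> space M. dist (Y m \<omega>) b > e / 2}) \<longlonglongrightarrow> 0"
    using Y e unfolding tends_in_prob_def by (meson half_gt_zero)
  ultimately show "?u \<longlonglongrightarrow> 0" by (rule tendsto_add_zero)
qed

lemma tends_in_prob_0_mono:
  fixes X Y :: "nat \<Rightarrow> 'a \<Rightarrow> real"
  assumes Y: "tends_in_prob M Y 0" and le: "\<And>m \<omega>. \<omega> \<in> space M \<Longrightarrow> \<bar>X m \<omega>\<bar> \<le> \<bar>Y m \<omega>\<bar>"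
    and [measurable]: "\<And>m. Y m \<in> borel_measurable M"
  shows "tends_in_prob M X 0"
proof (rule tends_in_prob_bound)
  fix e :: real assume e: "0 < e"
  have "measure M {\<omega> \<in> space M. dist (X m \<omega>) 0 > e} \<le> measure M {\<omega> \<in> space M. dist (Y m \<omega>) 0 > e}" for m
    by (rule finite_measure_mono) (use le[of _ m] in \<open>auto intro: less_le_trans\<close>)
  then show "eventually (\<lambda>m. measure M {\<omega> \<in> space M. dist (X m \<omega>) 0 > e}
      \<le> measure M {\<omega> \<in> space M. dist (Y m \<omega>) 0 > e}) sequentially" by simp
  show "(\<lambda>m. measure M {\<omega> \<in> space M. dist (Y m \<omega>) 0 > e}) \<longlonglongrightarrow> 0"
    using Y e by (simp add: tends_in_prob_def)
qed

text \<open>The rule O_P(1) o_P(1) = o_P(1): a product above e needs a first factor above B or a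
  second one above e / B, and B is fixed before m grows.\<close>

lemma bounded_times_tends_in_prob_0:
  fixes X D :: "nat \<Rightarrow> 'a \<Rightarrow> real"
  assumes X: "bounded_in_prob M X" and D: "tends_in_prob M D 0"
    and [measurable]: "\<And>m. X m \<in> borel_measurable M" "\<And>m. D m \<in> borel_measurable M"
  shows "tends_in_prob M (\<lambda>m \<omega>. X m \<omega> * D m \<omega>) 0"
  unfolding tends_in_prob_def
proof (intro allI impI tendstoI)
  fix e \<epsilon> :: real assume e: "0 < e" "0 < \<epsilon>"
  then have "0 < \<epsilon> / 2" by simp
  with X obtain B where B: "0 < B"
    and X': "eventually (\<lambda>m. measure M {\<omega> \<in> space M. \<bar>X m \<omega>\<bar> > B} < \<epsilon> / 2) sequentially"
    unfolding bounded_in_prob_def by blast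
  have "(\<lambda>m. measure M {\<omega> \<in> space M. dist (D m \<omega>) 0 > e / B}) \<longlonglongrightarrow> 0"
    using D e(1) B by (simp add: tends_in_prob_def)
  from tendstoD[OF this \<open>0 < \<epsilon> / 2\<close>]
  have D': "eventually (\<lambda>m. measure M {\<omega> \<in> space M. \<bar>D m \<omega>\<bar> > e / B} < \<epsilon> / 2) sequentially"
    by simp
  have le: "measure M {\<omega> \<in> space M. dist (X m \<omega> * D m \<omega>) 0 > e}
      \<le> measure M {\<omega> \<in> space M. \<bar>X m \<omega>\<bar> > B} + measure M {\<omega> \<in> space M. \<bar>D m \<omega>\<bar> > e / B}" for m
  proof -
    have "measure M {\<omega> \<in> space M. dist (X m \<omega> * D m \<omega>) 0 > e}
      \<le> measure M ({\<omega> \<in> space M. \<bar>X m \<omega>\<bar> > B} \<union> {\<omega> \<in> space M. \<bar>D m \<omega>\<bar> > e / B})"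
    proof (rule finite_measure_mono)
      have "B < \<bar>X m \<omega>\<bar> \<or> e / B < \<bar>D m \<omega>\<bar>" if "e < \<bar>X m \<omega> * D m \<omega>\<bar>" for \<omega>
      proof (rule ccontr)
        assume "\<not> ?thesis"
        then have *: "\<bar>X m \<omega>\<bar> \<le> B" "\<bar>D m \<omega>\<bar> \<le> e / B" by simp_all
        have "\<bar>X m \<omega> * D m \<omega>\<bar> \<le> B * (e / B)"
          unfolding abs_mult using * B by (intro mult_mono) auto
        then show False using B that by simp
      qed
      then show "{\<omega> \<in> space M. dist (X m \<omega> * D m \<omega>) 0 > e}
        \<subseteq> {\<omega> \<in> space M. \<bar>X m \<omega>\<bar> > B} \<union> {\<omega> \<in> space M. \<bar>D m \<omega>\<bar> > e / B}"
        by auto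
    qed measurable
    also have "\<dots> \<le> measure M {\<omega> \<in> space M. \<bar>X m \<omega>\<bar> > B} + measure M {\<omega> \<in> space M. \<bar>D m \<omega>\<bar> > e / B}"
      by (rule measure_Un_le) measurable
    finally show ?thesis .
  qed
  show "eventually (\<lambda>m. dist (measure M {\<omega> \<in> space M. dist (X m \<omega> * D m \<omega>) 0 > e}) 0 < \<epsilon>) sequentially"
    using X' D'
  proof eventually_elim
    case (elim m)
    with le[of m] show ?case by (simp add: dist_real_def)
  qed
qed

section \<open>Tightness and Slutsky's theorem by means of distribution functions\<close>

lemma cdf_distr_eq:
  assumes [measurable]: "X \<in> borel_measurable M"
  shows "cdf (distr M borel X) x = measure M {\<omega> \<in> space M. X \<omega> \<le> x}"
  unfolding cdf_def by (subst measure_distr) (auto intro!: arg_cong[where f = "measure M"])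

text \<open>B is chosen in the tails of the limit law, and distribution functions are compared at B
  and -B; both are points of convergence because the limit has a continuous distribution
  function.\<close>

lemma weak_conv_m_imp_bounded_in_prob:
  assumes conv: "weak_conv_m (\<lambda>m. distr M borel (X m)) L" and L: "real_distribution L"
    and cont: "\<And>x. isCont (cdf L) x"
    and [measurable]: "\<And>m. X m \<in> borel_measurable M"
  shows "bounded_in_prob M X"
  unfolding bounded_in_prob_def
proof (intro allI impI)
  interpret L: real_distribution L by fact
  fix e :: real assume e: "0 < e"
  have "eventually (\<lambda>B. 1 - e / 2 < cdf L B) at_top"
    using L.cdf_lim_at_top_prob e by (intro order_tendstoD) auto
  moreover have "eventually (\<lambda>B. cdf L (- B) < e / 2) at_top"
    using L.cdf_lim_at_bot e
    by (intro order_tendstoD(2)[of _ 0] filterlim_compose[OF _ filterlim_uminus_at_bot_at_top]) auto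
  moreover have "eventually (\<lambda>B. 0 < B) (at_top :: real filter)" by (rule eventually_gt_at_top)
  ultimately have "eventually (\<lambda>B. 1 - e / 2 < cdf L B \<and> cdf L (- B) < e / 2 \<and> 0 < B) at_top"
    by eventually_elim simp
  then obtain B where B: "1 - e / 2 < cdf L B" "cdf L (- B) < e / 2" "0 < B"
    using eventually_happens'[OF trivial_limit_at_top_linorder] by blast
  have F: "(\<lambda>m. cdf (distr M borel (X m)) x) \<longlonglongrightarrow> cdf L x" for x
    using conv cont unfolding weak_conv_m_def weak_conv_def by blast
  have le: "measure M {\<omega> \<in> space M. \<bar>X m \<omega>\<bar> > B}
      \<le> 1 - cdf (distr M borel (X m)) B + cdf (distr M borel (X m)) (- B)" for m
  proof -
    have "measure M {\<omega> \<in> space M. \<bar>X m \<omega>\<bar> > B}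
        \<le> measure M ({\<omega> \<in> space M. \<not> X m \<omega> \<le> B} \<union> {\<omega> \<in> space M. X m \<omega> \<le> - B})"
      by (rule finite_measure_mono) auto
    also have "\<dots> \<le> measure M {\<omega> \<in> space M. \<not> X m \<omega> \<le> B} + measure M {\<omega> \<in> space M. X m \<omega> \<le> - B}"
      by (rule measure_Un_le) measurable
    also have "measure M {\<omega> \<in> space M. \<not> X m \<omega> \<le> B} = 1 - measure M {\<omega> \<in> space M. X m \<omega> \<le> B}"
      by (rule prob_neg) measurable
    finally show ?thesis by (simp add: cdf_distr_eq)
  qed
  have "eventually (\<lambda>m. 1 - e / 2 < cdf (distr M borel (X m)) B) sequentially"
    using order_tendstoD(1)[OF F B(1)] .
  moreover have "eventually (\<lambda>m. cdf (distr M borel (X m)) (- B) < e / 2) sequentially"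
    using order_tendstoD(2)[OF F B(2)] .
  ultimately have "eventually (\<lambda>m. measure M {\<omega> \<in> space M. \<bar>X m \<omega>\<bar> > B} < e) sequentially"
  proof eventually_elim
    case (elim m)
    with le[of m] show ?case by linarith
  qed
  with B(3) show "\<exists>B>0. eventually (\<lambda>m. measure M {\<omega> \<in> space M. \<bar>X m \<omega>\<bar> > B} < e) sequentially"
    by blast
qed

text \<open>A shift by d traps the distribution function of X m at x between those of W m at x - d
  and x + d, up to the probability that the two variables differ by more than d. The thirds of e pay
  for the continuity of the limit, the convergence of W m at the shifted points, and that
  probability.\<close>

lemma weak_conv_m_Slutsky:
  assumes conv: "weak_conv_m (\<lambda>m. distr M borel (W m)) L"
    and cont: "\<And>x. isCont (cdf L) x"
    and diff: "tends_in_prob M (\<lambda>m \<omega>. X m \<omega> - W m \<omega>) 0"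
    and [measurable]: "\<And>m. X m \<in> borel_measurable M" "\<And>m. W m \<in> borel_measurable M"
  shows "weak_conv_m (\<lambda>m. distr M borel (X m)) L"
  unfolding weak_conv_m_def weak_conv_def
proof (intro allI impI tendstoI)
  fix x e :: real assume e: "0 < e"
  let ?p = "\<lambda>d m. measure M {\<omega> \<in> space M. \<bar>X m \<omega> - W m \<omega>\<bar> > d}"
  have F: "(\<lambda>m. cdf (distr M borel (W m)) x) \<longlonglongrightarrow> cdf L x" for x
    using conv cont unfolding weak_conv_m_def weak_conv_def by blast
  obtain d0 where d0: "0 < d0" "\<And>y. dist y x < d0 \<Longrightarrow> dist (cdf L y) (cdf L x) < e / 3"
    using cont[of x] e unfolding continuous_at_eps_delta by (metis zero_less_divide_iff zero_less_numeral)
  define d where "d = d0 / 2"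
  have d: "0 < d" "\<bar>cdf L (x + d) - cdf L x\<bar> < e / 3" "\<bar>cdf L (x - d) - cdf L x\<bar> < e / 3"
    using d0(1) d0(2)[of "x + d"] d0(2)[of "x - d"] by (auto simp: d_def dist_real_def)
  have "(\<lambda>m. ?p d m) \<longlonglongrightarrow> 0"
    using diff d(1) by (simp add: tends_in_prob_def dist_real_def)
  from tendstoD[OF this, of "e / 3"] e have 1: "eventually (\<lambda>m. ?p d m < e / 3) sequentially"
    by simp
  have 2: "eventually (\<lambda>m. \<bar>cdf (distr M borel (W m)) y - cdf L y\<bar> < e / 3) sequentially" for y
    using tendstoD[OF F, of "e / 3" y] e by (simp add: dist_real_def)
  have shift: "measure M {\<omega> \<in> space M. U \<omega> \<le> y} \<le> measure M {\<omega> \<in> space M. V \<omega> \<le> y + d}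
      + measure M {\<omega> \<in> space M. \<bar>U \<omega> - V \<omega>\<bar> > d}"
    if [measurable]: "U \<in> borel_measurable M" "V \<in> borel_measurable M" for U V :: "'a \<Rightarrow> real" and y
  proof -
    have "measure M {\<omega> \<in> space M. U \<omega> \<le> y}
        \<le> measure M ({\<omega> \<in> space M. V \<omega> \<le> y + d} \<union> {\<omega> \<in> space M. \<bar>U \<omega> - V \<omega>\<bar> > d})"
      by (rule finite_measure_mono) auto
    also have "\<dots> \<le> measure M {\<omega> \<in> space M. V \<omega> \<le> y + d}
      + measure M {\<omega> \<in> space M. \<bar>U \<omega> - V \<omega>\<bar> > d}"
      by (rule measure_Un_le) measurable
    finally show ?thesis .
  qed
  have up: "cdf (distr M borel (X m)) x \<le> cdf (distr M borel (W m)) (x + d) + ?p d m" for m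
    using shift[of "X m" "W m" x] by (simp add: cdf_distr_eq)
  have lo: "cdf (distr M borel (W m)) (x - d) \<le> cdf (distr M borel (X m)) x + ?p d m" for m
    using shift[of "W m" "X m" "x - d"] by (simp add: cdf_distr_eq abs_minus_commute)
  show "eventually (\<lambda>m. dist (cdf (distr M borel (X m)) x) (cdf L x) < e) sequentially"
    using 1 2[of "x + d"] 2[of "x - d"]
  proof eventually_elim
    case (elim m)
    with up[of m] lo[of m] d show ?case unfolding dist_real_def by linarith
  qed
qed

end

text \<open>Links the two notions of weak convergence: asymptotic normality is a statement about the
  plane, the conclusions concern the line. A bounded continuous test function composed with h is
  again bounded and continuous.\<close>

lemma weak_conv_top_continuous_image:
  fixes h :: "'b::topological_space \<Rightarrow> real"
  assumes conv: "weak_conv_top \<mu>s \<mu>" and h: "continuous_on UNIV h"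
    and prob: "\<And>m. prob_space (\<mu>s m)" "prob_space \<mu>"
    and sets: "\<And>m. sets (\<mu>s m) = sets borel" "sets \<mu> = sets borel"
  shows "weak_conv_m (\<lambda>m. distr (\<mu>s m) borel h) (distr \<mu> borel h)"
proof (rule integral_bdd_continuous_conv_imp_weak_conv)
  have [measurable]: "h \<in> borel_measurable borel" using h by (rule borel_measurable_continuous_onI)
  have h_meas: "h \<in> borel_measurable (\<mu>s m)" "h \<in> borel_measurable \<mu>" for m
    by (simp_all cong: measurable_cong_sets add: sets)
  show "real_distribution (distr (\<mu>s m) borel h)" for m
    using prob_space.real_distribution_distr[OF prob(1) h_meas(1)] .
  show "real_distribution (distr \<mu> borel h)"
    using prob_space.real_distribution_distr[OF prob(2) h_meas(2)] .
  fix f :: "real \<Rightarrow> real" assume f: "\<And>x. isCont f x" "\<And>x. \<bar>f x\<bar> \<le> 1"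
  have cf: "continuous_on UNIV f" using f(1) by (simp add: continuous_on_eq_continuous_at)
  then have [measurable]: "f \<in> borel_measurable borel" by (rule borel_measurable_continuous_onI)
  have "continuous_on UNIV (\<lambda>x. f (h x))"
    using cf h by (rule continuous_on_compose2) simp
  moreover have "bounded (range (\<lambda>x. f (h x)))"
    using f(2) by (auto simp: bounded_iff intro!: exI[of _ 1])
  ultimately have "(\<lambda>m. \<integral>x. f (h x) \<partial>(\<mu>s m)) \<longlonglongrightarrow> (\<integral>x. f (h x) \<partial>\<mu>)"
    using conv unfolding weak_conv_top_def by blast
  then show "(\<lambda>m. integral\<^sup>L (distr (\<mu>s m) borel h) f) \<longlonglongrightarrow> integral\<^sup>L (distr \<mu> borel h) f"
    by (simp add: integral_distr h_meas)
qed

lemma weak_conv_m_continuous_image: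
  fixes h :: "real \<Rightarrow> real"
  assumes conv: "weak_conv_m \<mu>s \<mu>" and h: "continuous_on UNIV h"
    and prob: "\<And>m. real_distribution (\<mu>s m)" "real_distribution \<mu>"
  shows "weak_conv_m (\<lambda>m. distr (\<mu>s m) borel h) (distr \<mu> borel h)"
proof (rule weak_conv_top_continuous_image)
  show "weak_conv_top \<mu>s \<mu>"
    unfolding weak_conv_top_def
  proof safe
    fix f :: "real \<Rightarrow> real" assume f: "continuous_on UNIV f" "bounded (range f)"
    then obtain B where "\<And>x. norm (f x) \<le> B" by (auto simp: bounded_iff)
    with f(1) show "(\<lambda>m. integral\<^sup>L (\<mu>s m) f) \<longlonglongrightarrow> integral\<^sup>L \<mu> f"
      by (intro weak_conv_imp_integral_bdd_continuous_conv[OF prob conv])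
        (auto simp: continuous_on_eq_continuous_at)
  qed
qed (use h prob in \<open>auto simp: real_distribution_def real_distribution_axioms_def\<close>)

section \<open>Limits of Sobel's statistic\<close>

abbreviation (input) normal_law :: "real \<Rightarrow> real measure" where
  "normal_law \<sigma> \<equiv> density lborel (normal_density 0 \<sigma>)"

lemma real_distribution_normal_law: "0 < \<sigma> \<Longrightarrow> real_distribution (normal_law \<sigma>)"
  by (auto simp: real_distribution_def real_distribution_axioms_def prob_space_normal_density)

lemma isCont_cdf_normal_law:
  assumes "0 < \<sigma>"
  shows "isCont (cdf (normal_law \<sigma>)) x"
proof -
  interpret real_distribution "normal_law \<sigma>" using assms by (rule real_distribution_normal_law)
  have "AE y in lborel. y \<in> {x} \<longrightarrow> ennreal (normal_density 0 \<sigma> y) = 0"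
    using AE_lborel_singleton[of x] by eventually_elim simp
  then have "{x} \<in> null_sets (normal_law \<sigma>)"
    by (subst null_sets_density_iff) simp_all
  then have "measure (normal_law \<sigma>) {x} = 0" by (simp add: measure_def null_setsD1)
  then show ?thesis by (simp add: isCont_cdf)
qed

lemma distr_normal_law_scale:
  assumes "0 < \<sigma>" "k \<noteq> 0"
  shows "distr (normal_law \<sigma>) borel (\<lambda>x. k * x) = normal_law (\<bar>k\<bar> * \<sigma>)"
proof -
  interpret real_distribution "normal_law \<sigma>" using assms(1) by (rule real_distribution_normal_law)
  have "distributed (normal_law \<sigma>) lborel (\<lambda>x. x) (normal_density 0 \<sigma>)"
    using assms(1) by (auto simp: distributed_def intro!: distr_id2)
  from normal_density_affine[OF this assms, of 0]
  have "distr (normal_law \<sigma>) lborel (\<lambda>x. k * x) = normal_law (\<bar>k\<bar> * \<sigma>)"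
    by (simp add: distributed_def)
  then show ?thesis by (simp cong: distr_cong)
qed

section \<open>Regularity of Sobel's function and its law under independent normals\<close>

lemma sobel_mult:
  assumes "0 < r"
  shows "sobel (r * a) (r * b) = r * sobel a b"
proof -
  have "sqrt ((r * a)\<^sup>2 + (r * b)\<^sup>2) = r * sqrt (a\<^sup>2 + b\<^sup>2)"
    using assms by (simp add: power_mult_distrib real_sqrt_mult flip: distrib_left)
  then show ?thesis using assms by (simp add: sobel_def)
qed

lemma sobel_commute: "sobel a b = sobel b a"
  by (simp add: sobel_def add.commute mult.commute)

text \<open>For b \<noteq> 0 the derivative in the first argument is the cube of b / sqrt (x^2 +
  b^2), a number of absolute value at most 1; for b = 0 the function vanishes identically.\<close>

lemma sobel_lipschitz_left: "\<bar>sobel a b - sobel a' b\<bar> \<le> \<bar>a - a'\<bar>"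
proof (cases "b = 0")
  case False
  let ?r = "\<lambda>x. sqrt (x\<^sup>2 + b\<^sup>2)"
  have r: "0 < x\<^sup>2 + b\<^sup>2" for x using False by (simp add: add_nonneg_pos)
  have "norm (sobel a b - sobel a' b) \<le> 1 * norm (a - a')"
  proof (rule field_differentiable_bound[where S = UNIV])
    fix x :: real
    show "((\<lambda>x. sobel x b) has_field_derivative (b / ?r x) ^ 3) (at x within UNIV)"
    proof -
      have r2: "?r x * ?r x = x\<^sup>2 + b\<^sup>2" using r[of x] by simp
      have "(b * ?r x - x * b * (x / ?r x)) / (?r x * ?r x)
          = b * (?r x * ?r x - x\<^sup>2) / (?r x * (?r x * ?r x))"
        using r[of x] by (simp add: divide_simps) (simp add: power2_eq_square algebra_simps)
      also have "\<dots> = (b / ?r x) ^ 3"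
        unfolding r2 by (simp add: power3_eq_cube power2_eq_square mult_ac)
      finally have e: "(b * ?r x - x * b * (x / ?r x)) / (?r x * ?r x) = (b / ?r x) ^ 3" .
      have "((\<lambda>x. x * b / ?r x) has_field_derivative
          (b * ?r x - x * b * (x / ?r x)) / (?r x * ?r x)) (at x)"
        using r[of x] by (auto intro!: derivative_eq_intros simp: field_simps)
      then show ?thesis unfolding e by (simp add: sobel_def)
    qed
    have "\<bar>b / ?r x\<bar> \<le> 1"
      using r[of x] by (simp add: abs_divide divide_le_eq_1 real_le_rsqrt)
    then show "norm ((b / ?r x) ^ 3) \<le> 1"
      by (simp only: real_norm_def power_abs power_le_one abs_ge_zero)
  qed auto
  then show ?thesis by simp
qed (simp add: sobel_def)

lemma sobel_lipschitz: "\<bar>sobel a b - sobel a' b'\<bar> \<le> \<bar>a - a'\<bar> + \<bar>b - b'\<bar>"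
  using sobel_lipschitz_left[of a b a'] sobel_lipschitz_left[of b a' b']
  by (simp add: sobel_commute[of a'])

text \<open>The origin is included: the quotient 0 / 0 has the default value 0, and the Lipschitz
  bound shows that this is the continuous extension. Continuous mapping therefore needs no
  exceptional point when both parameters vanish.\<close>

lemma continuous_on_sobel: "continuous_on UNIV (\<lambda>z. sobel (fst z) (snd z))"
  unfolding continuous_on_eq_continuous_at[OF open_UNIV]
proof
  fix z :: "real \<times> real"
  have "((\<lambda>w. \<bar>fst w - fst z\<bar> + \<bar>snd w - snd z\<bar>) \<longlongrightarrow> \<bar>fst z - fst z\<bar> + \<bar>snd z - snd z\<bar>) (at z)"
    by (intro tendsto_intros)
  then have "((\<lambda>w. \<bar>fst w - fst z\<bar> + \<bar>snd w - snd z\<bar>) \<longlongrightarrow> 0) (at z)" by simp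
  then have "((\<lambda>w. sobel (fst w) (snd w) - sobel (fst z) (snd z)) \<longlongrightarrow> 0) (at z)"
    by (rule Lim_null_comparison[rotated]) (simp add: sobel_lipschitz)
  then show "isCont (\<lambda>z. sobel (fst z) (snd z)) z"
    unfolding isCont_def by (simp add: LIM_zero_iff)
qed

lemma distr_sobel_std_normal:
  "distr std_normal_pair borel (\<lambda>z. 2 * sobel (fst z) (snd z)) = std_normal_distribution"
proof (rule measure_eqI)
  fix B assume "B \<in> sets (distr std_normal_pair borel (\<lambda>z. 2 * sobel (fst z) (snd z)))"
  then have [measurable]: "B \<in> sets borel" by simp
  have [measurable]: "(\<lambda>z. 2 * sobel (fst z) (snd z)) \<in> borel_measurable (borel \<Otimes>\<^sub>M borel)"
    unfolding sobel_def by measurable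
  have "emeasure (distr std_normal_pair borel (\<lambda>z. 2 * sobel (fst z) (snd z))) B
      = (\<integral>\<^sup>+x. indicator B x \<partial>distr std_normal_pair borel (\<lambda>z. 2 * sobel (fst z) (snd z)))"
    by simp
  also have "\<dots> = (\<integral>\<^sup>+z. indicator B (2 * sobel (fst z) (snd z)) \<partial>std_normal_pair)"
    by (rule nn_integral_distr) measurable
  also have "\<dots> = (\<integral>\<^sup>+x. indicator B x \<partial>std_normal_distribution)"
    unfolding sobel_def by (rule nn_integral_sobel_std_normal_pair) measurable
  finally show "emeasure (distr std_normal_pair borel (\<lambda>z. 2 * sobel (fst z) (snd z))) B
      = emeasure std_normal_distribution B" by simp
qed simp

lemma distr_sobel_normal_law:
  assumes "0 < \<sigma>" "0 < \<tau>"
  shows "distr (normal_law \<sigma> \<Otimes>\<^sub>M normal_law \<tau>) borel (\<lambda>z. 2 * sobel (fst z / \<sigma>) (snd z / \<tau>))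
    = std_normal_distribution"
proof -
  interpret S: real_distribution "normal_law \<sigma>" using assms by (rule_tac real_distribution_normal_law)
  interpret T: real_distribution "normal_law \<tau>" using assms by (rule_tac real_distribution_normal_law)
  have [measurable]: "(\<lambda>z. 2 * sobel (fst z) (snd z)) \<in> borel_measurable (borel \<Otimes>\<^sub>M borel)"
    unfolding sobel_def by measurable
  have scale: "distr (normal_law s) borel (\<lambda>x. x / s) = std_normal_distribution" if "0 < s" for s
    using distr_normal_law_scale[OF that, of "1 / s"] that by simp
  have "std_normal_pair = distr (normal_law \<sigma> \<Otimes>\<^sub>M normal_law \<tau>) (borel \<Otimes>\<^sub>M borel) (\<lambda>(x, y). (x / \<sigma>, y / \<tau>))"
    using pair_measure_distr[of "\<lambda>x. x / \<sigma>" "normal_law \<sigma>" borel "\<lambda>y. y / \<tau>" "normal_law \<tau>" borel]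
    by (simp add: scale assms prob_space_std_normal prob_space_imp_sigma_finite)
  with distr_sobel_std_normal have "distr (distr (normal_law \<sigma> \<Otimes>\<^sub>M normal_law \<tau>) (borel \<Otimes>\<^sub>M borel)
      (\<lambda>(x, y). (x / \<sigma>, y / \<tau>))) borel (\<lambda>z. 2 * sobel (fst z) (snd z)) = std_normal_distribution"
    by simp
  then show ?thesis
    by (subst (asm) distr_distr) (simp_all add: comp_def split_beta')
qed

section \<open>Limits of the statistic in the cases of the composite null hypothesis\<close>

context prob_space
begin

text \<open>A factor 1 / sqrt m turns boundedness into convergence to 0. Cancelling it against sqrt
  m fails at m = 0, where 1 / 0 = 0, so the identity is only claimed eventually.\<close>

lemma bounded_in_prob_imp_tends_in_prob:
  assumes "bounded_in_prob M (\<lambda>m \<omega>. sqrt (real m) * X m \<omega>)"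
    and [measurable]: "\<And>m. X m \<in> borel_measurable M"
  shows "tends_in_prob M X 0"
proof -
  have "(\<lambda>m. 1 / sqrt (real m)) \<longlonglongrightarrow> 0"
    by (intro tendsto_divide_0[OF tendsto_const] filterlim_at_top_imp_at_infinity
        filterlim_compose[OF sqrt_at_top filterlim_real_sequentially])
  then have "tends_in_prob M (\<lambda>m \<omega>. 1 / sqrt (real m)) 0" by (rule tends_in_prob_const)
  with assms(1) have "tends_in_prob M (\<lambda>m \<omega>. sqrt (real m) * X m \<omega> * (1 / sqrt (real m))) 0"
    by (rule bounded_times_tends_in_prob_0) simp_all
  moreover have "eventually (\<lambda>m. \<forall>\<omega>\<in>space M. sqrt (real m) * X m \<omega> * (1 / sqrt (real m)) = X m \<omega>) sequentially"
    using eventually_gt_at_top[of 0] by eventually_elim simp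
  note tends_in_prob_cong[OF this, of 0]
  ultimately show ?thesis by blast
qed

text \<open>When only one of the two parameters vanishes, Sobel's statistic is asymptotically the
  standardised estimator of the vanishing one, up to the sign of the other.\<close>

lemma sobel_limit_one_null:
  fixes a e v w :: "nat \<Rightarrow> 'a \<Rightarrow> real"
  assumes a: "weak_conv_m (\<lambda>m. distr M borel (\<lambda>\<omega>. sqrt (real m) * a m \<omega>)) (normal_law \<sigma>)"
    and e: "weak_conv_m (\<lambda>m. distr M borel (\<lambda>\<omega>. sqrt (real m) * (e m \<omega> - \<eta>))) (normal_law \<tau>)"
    and v: "tends_in_prob M v (\<sigma>\<^sup>2)" and w: "tends_in_prob M w (\<tau>\<^sup>2)"
    and pos: "0 < \<sigma>" "0 < \<tau>" and \<eta>: "\<eta> \<noteq> 0"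
    and [measurable]: "\<And>m. a m \<in> borel_measurable M" "\<And>m. e m \<in> borel_measurable M"
      "\<And>m. v m \<in> borel_measurable M" "\<And>m. w m \<in> borel_measurable M"
  shows "weak_conv_m (\<lambda>m. distr M borel (\<lambda>\<omega>.
      sobel (sqrt (real m) * a m \<omega> / sqrt (v m \<omega>)) (sqrt (real m) * e m \<omega> / sqrt (w m \<omega>))))
    std_normal_distribution"
proof -
  \<comment> \<open>By homogeneity of Sobel's function sqrt m comes out, and the statistic is sqrt m
    * a m times \<open>g\<close> of the unscaled estimators. These converge in probability, hence so
    does \<open>g\<close>, and sqrt m * a m is the only fluctuating factor left.\<close>
  define g where "g = (\<lambda>(x, y, p, q). 1 / sqrt p * (y / sqrt q / sqrt ((x / sqrt p)\<^sup>2 + (y / sqrt q)\<^sup>2)))"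
  define c where "c = g (0, \<eta>, \<sigma>\<^sup>2, \<tau>\<^sup>2)"
  \<comment> \<open>At x = 0 the quotient in \<open>g\<close> reduces to y / \<bar>y\<bar>, the
    origin of the sign; since \<bar>c\<bar> * \<sigma> = 1, the limit is standard normal.\<close>
  have c_eq: "c = sgn \<eta> / \<sigma>"
    using pos \<eta> by (simp add: c_def g_def sgn_real_def)
  have ba: "bounded_in_prob M (\<lambda>m \<omega>. sqrt (real m) * a m \<omega>)"
    by (rule weak_conv_m_imp_bounded_in_prob[OF a real_distribution_normal_law isCont_cdf_normal_law])
       (simp_all add: pos)
  have be: "bounded_in_prob M (\<lambda>m \<omega>. sqrt (real m) * (e m \<omega> - \<eta>))"
    by (rule weak_conv_m_imp_bounded_in_prob[OF e real_distribution_normal_law isCont_cdf_normal_law])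
       (simp_all add: pos)
  have a0: "tends_in_prob M a 0"
    by (rule bounded_in_prob_imp_tends_in_prob[OF ba]) simp
  have e0: "tends_in_prob M e \<eta>"
    unfolding tends_in_prob_diff_iff[symmetric, of M e \<eta>]
    by (rule bounded_in_prob_imp_tends_in_prob[OF be]) simp
  let ?D = "\<lambda>m \<omega>. g (a m \<omega>, e m \<omega>, v m \<omega>, w m \<omega>)"
  have "tends_in_prob M (\<lambda>m \<omega>. (a m \<omega>, e m \<omega>, v m \<omega>, w m \<omega>)) (0, \<eta>, \<sigma>\<^sup>2, \<tau>\<^sup>2)"
    by (intro tends_in_prob_Pair a0 e0 v w) (simp_all add: borel_prod[symmetric])
  moreover have "isCont g (0, \<eta>, \<sigma>\<^sup>2, \<tau>\<^sup>2)"
    unfolding g_def split_beta' using pos \<eta> by (intro continuous_intros) simp_all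
  ultimately have "tends_in_prob M ?D c"
    unfolding c_def by (rule tends_in_prob_isCont) (simp add: borel_prod[symmetric])
  then have "tends_in_prob M (\<lambda>m \<omega>. ?D m \<omega> - c) 0"
    by (simp add: tends_in_prob_diff_iff)
  with ba have "tends_in_prob M (\<lambda>m \<omega>. sqrt (real m) * a m \<omega> * (?D m \<omega> - c)) 0"
    by (rule bounded_times_tends_in_prob_0) (simp_all add: g_def)
  moreover have "eventually (\<lambda>m. \<forall>\<omega>\<in>space M. sqrt (real m) * a m \<omega> * (?D m \<omega> - c)
      = sobel (sqrt (real m) * a m \<omega> / sqrt (v m \<omega>)) (sqrt (real m) * e m \<omega> / sqrt (w m \<omega>))
        - c * (sqrt (real m) * a m \<omega>)) sequentially"
    using eventually_gt_at_top[of 0]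
  proof eventually_elim
    case (elim m)
    then have *: "sobel (sqrt (real m) * (x / sqrt p)) (sqrt (real m) * (y / sqrt q))
        = sqrt (real m) * x * g (x, y, p, q)" for x y p q
      by (subst sobel_mult) (simp_all add: g_def sobel_def)
    show ?case
    proof
      fix \<omega>
      show "sqrt (real m) * a m \<omega> * (?D m \<omega> - c)
        = sobel (sqrt (real m) * a m \<omega> / sqrt (v m \<omega>)) (sqrt (real m) * e m \<omega> / sqrt (w m \<omega>))
          - c * (sqrt (real m) * a m \<omega>)"
        using *[of "a m \<omega>" "v m \<omega>" "e m \<omega>" "w m \<omega>"] by (simp add: right_diff_distrib mult.commute[of c])
    qed
  qed
  note tends_in_prob_cong[OF this, of 0]
  ultimately have diff: "tends_in_prob M (\<lambda>m \<omega>.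
      sobel (sqrt (real m) * a m \<omega> / sqrt (v m \<omega>)) (sqrt (real m) * e m \<omega> / sqrt (w m \<omega>))
        - c * (sqrt (real m) * a m \<omega>)) 0"
    by blast
  have "weak_conv_m (\<lambda>m. distr (distr M borel (\<lambda>\<omega>. sqrt (real m) * a m \<omega>)) borel (\<lambda>x. c * x))
      (distr (normal_law \<sigma>) borel (\<lambda>x. c * x))"
    by (rule weak_conv_m_continuous_image[OF a])
       (auto intro!: continuous_intros real_distribution_normal_law real_distribution_distr pos)
  also have "distr (normal_law \<sigma>) borel (\<lambda>x. c * x) = std_normal_distribution"
    using pos \<eta> by (subst distr_normal_law_scale) (auto simp: c_eq abs_sgn_eq sgn_eq_0_iff)
  finally have W: "weak_conv_m (\<lambda>m. distr M borel (\<lambda>\<omega>. c * (sqrt (real m) * a m \<omega>))) std_normal_distribution"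
    by (simp add: distr_distr comp_def)
  show ?thesis
    by (rule weak_conv_m_Slutsky[OF W _ diff]) (simp_all add: isCont_cdf_normal_law sobel_def)
qed

text \<open>The factor 2 compensates the limiting variance 1/4.\<close>

lemma sobel_limit_both_null:
  fixes a e v w :: "nat \<Rightarrow> 'a \<Rightarrow> real"
  assumes conv: "weak_conv_top (\<lambda>m. distr M borel (\<lambda>\<omega>. (sqrt (real m) * a m \<omega>, sqrt (real m) * e m \<omega>)))
      (normal_law \<sigma> \<Otimes>\<^sub>M normal_law \<tau>)"
    and a: "bounded_in_prob M (\<lambda>m \<omega>. sqrt (real m) * a m \<omega>)"
    and e: "bounded_in_prob M (\<lambda>m \<omega>. sqrt (real m) * e m \<omega>)"
    and v: "tends_in_prob M v (\<sigma>\<^sup>2)" and w: "tends_in_prob M w (\<tau>\<^sup>2)"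
    and pos: "0 < \<sigma>" "0 < \<tau>"
    and [measurable]: "\<And>m. a m \<in> borel_measurable M" "\<And>m. e m \<in> borel_measurable M"
      "\<And>m. v m \<in> borel_measurable M" "\<And>m. w m \<in> borel_measurable M"
  shows "weak_conv_m (\<lambda>m. distr M borel (\<lambda>\<omega>.
      2 * sobel (sqrt (real m) * a m \<omega> / sqrt (v m \<omega>)) (sqrt (real m) * e m \<omega> / sqrt (w m \<omega>))))
    std_normal_distribution"
proof -
  interpret S: real_distribution "normal_law \<sigma>" using pos by (rule_tac real_distribution_normal_law)
  interpret T: real_distribution "normal_law \<tau>" using pos by (rule_tac real_distribution_normal_law)
  let ?A = "\<lambda>m \<omega>. sqrt (real m) * a m \<omega>" and ?E = "\<lambda>m \<omega>. sqrt (real m) * e m \<omega>"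
  let ?h = "\<lambda>z. 2 * sobel (fst z / \<sigma>) (snd z / \<tau>)"
  have h: "continuous_on UNIV ?h"
    by (intro continuous_intros continuous_on_compose2[OF continuous_on_sobel, of _ "\<lambda>z. (fst z / \<sigma>, snd z / \<tau>)", simplified])
      (use pos in auto)
  have [measurable]: "(\<lambda>\<omega>. (?A m \<omega>, ?E m \<omega>)) \<in> borel_measurable M" for m
    by (simp add: borel_prod[symmetric])
  have "weak_conv_m (\<lambda>m. distr (distr M borel (\<lambda>\<omega>. (?A m \<omega>, ?E m \<omega>))) borel ?h)
      (distr (normal_law \<sigma> \<Otimes>\<^sub>M normal_law \<tau>) borel ?h)"
    by (rule weak_conv_top_continuous_image[OF conv h])
      (auto intro!: prob_space_distr prob_space_pair S.prob_space_axioms T.prob_space_axioms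
        simp: borel_prod[symmetric] cong: sets_pair_measure_cong)
  then have W: "weak_conv_m (\<lambda>m. distr M borel (\<lambda>\<omega>. 2 * sobel (?A m \<omega> / \<sigma>) (?E m \<omega> / \<tau>)))
      std_normal_distribution"
    using borel_measurable_continuous_onI[OF h]
    by (simp add: distr_sobel_normal_law[OF pos] distr_distr comp_def)
  \<comment> \<open>Replacing the estimated standard deviations by the true ones costs an error
    O_P(1) o_P(1) in each argument, and the Lipschitz bound carries it over to the
    statistic.\<close>
  have inv: "tends_in_prob M (\<lambda>m \<omega>. 1 / sqrt (u m \<omega>) - 1 / s) 0"
    if "tends_in_prob M u (s\<^sup>2)" "0 < s" and [measurable]: "\<And>m. u m \<in> borel_measurable M" for u s
  proof -
    have "isCont (\<lambda>x. 1 / sqrt x) (s\<^sup>2)"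
      using that(2) by (intro continuous_intros) simp
    from tends_in_prob_isCont[OF that(1) this] that(2,3) show ?thesis
      by (simp add: tends_in_prob_diff_iff)
  qed
  let ?a = "\<lambda>m \<omega>. ?A m \<omega> * (1 / sqrt (v m \<omega>) - 1 / \<sigma>)" and ?e = "\<lambda>m \<omega>. ?E m \<omega> * (1 / sqrt (w m \<omega>) - 1 / \<tau>)"
  have "tends_in_prob M ?a 0"
    by (rule bounded_times_tends_in_prob_0[OF a inv[OF v]]) (simp_all add: pos)
  moreover have "tends_in_prob M ?e 0"
    by (rule bounded_times_tends_in_prob_0[OF e inv[OF w]]) (simp_all add: pos)
  ultimately have "tends_in_prob M (\<lambda>m \<omega>. (?a m \<omega>, ?e m \<omega>)) (0, 0)"
    by (rule tends_in_prob_Pair) simp_all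
  moreover have "isCont (\<lambda>z::real \<times> real. 2 * (\<bar>fst z\<bar> + \<bar>snd z\<bar>)) (0, 0)"
    by (intro continuous_intros)
  ultimately have "tends_in_prob M (\<lambda>m \<omega>. 2 * (\<bar>?a m \<omega>\<bar> + \<bar>?e m \<omega>\<bar>)) 0"
    using tends_in_prob_isCont[of "\<lambda>m \<omega>. (?a m \<omega>, ?e m \<omega>)" "(0, 0)" "\<lambda>z. 2 * (\<bar>fst z\<bar> + \<bar>snd z\<bar>)"]
    by (simp add: borel_prod[symmetric])
  then have diff: "tends_in_prob M (\<lambda>m \<omega>. 2 * sobel (?A m \<omega> / sqrt (v m \<omega>)) (?E m \<omega> / sqrt (w m \<omega>))
      - 2 * sobel (?A m \<omega> / \<sigma>) (?E m \<omega> / \<tau>)) 0"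
  proof (rule tends_in_prob_0_mono)
    fix m \<omega>
    have "\<bar>sobel (?A m \<omega> / sqrt (v m \<omega>)) (?E m \<omega> / sqrt (w m \<omega>)) - sobel (?A m \<omega> / \<sigma>) (?E m \<omega> / \<tau>)\<bar>
        \<le> \<bar>?a m \<omega>\<bar> + \<bar>?e m \<omega>\<bar>"
      using sobel_lipschitz by (simp add: right_diff_distrib)
    then show "\<bar>2 * sobel (?A m \<omega> / sqrt (v m \<omega>)) (?E m \<omega> / sqrt (w m \<omega>))
      - 2 * sobel (?A m \<omega> / \<sigma>) (?E m \<omega> / \<tau>)\<bar> \<le> \<bar>2 * (\<bar>?a m \<omega>\<bar> + \<bar>?e m \<omega>\<bar>)\<bar>"
      by (simp only: abs_mult abs_numeral abs_of_nonneg abs_ge_zero add_nonneg_nonneg flip: right_diff_distrib) simp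
  qed simp
  show ?thesis
    by (rule weak_conv_m_Slutsky[OF W _ diff]) (simp_all add: isCont_cdf_normal_law sobel_def)
qed

end

text \<open>The constant is 1 when exactly one parameter vanishes and 2 when both do. Only its
  existence is exported, since a common positive factor does not alter the split statistic. Marginal
  limits come from the two projections, and symmetry of Sobel's function reduces the case \<eta> = 0
  \<noteq> \<alpha> to the opposite one with the estimators exchanged.\<close>

lemma (in prob_space) sobel_limit_null:
  fixes a e v w :: "nat \<Rightarrow> 'a \<Rightarrow> real"
  assumes conv: "weak_conv_top (\<lambda>m. distr M borel (\<lambda>\<omega>.
        (sqrt (real m) * (a m \<omega> - \<alpha>), sqrt (real m) * (e m \<omega> - \<eta>))))
      (normal_law \<sigma> \<Otimes>\<^sub>M normal_law \<tau>)"
    and v: "tends_in_prob M v (\<sigma>\<^sup>2)" and w: "tends_in_prob M w (\<tau>\<^sup>2)"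
    and pos: "0 < \<sigma>" "0 < \<tau>" and null: "\<alpha> * \<eta> = 0"
    and [measurable]: "\<And>m. a m \<in> borel_measurable M" "\<And>m. e m \<in> borel_measurable M"
      "\<And>m. v m \<in> borel_measurable M" "\<And>m. w m \<in> borel_measurable M"
  obtains c where "0 < c" "weak_conv_m (\<lambda>m. distr M borel (\<lambda>\<omega>.
      c * sobel (sqrt (real m) * a m \<omega> / sqrt (v m \<omega>)) (sqrt (real m) * e m \<omega> / sqrt (w m \<omega>))))
    std_normal_distribution"
proof -
  interpret S: real_distribution "normal_law \<sigma>" using pos by (rule_tac real_distribution_normal_law)
  interpret T: real_distribution "normal_law \<tau>" using pos by (rule_tac real_distribution_normal_law)
  let ?X = "\<lambda>m \<omega>. (sqrt (real m) * (a m \<omega> - \<alpha>), sqrt (real m) * (e m \<omega> - \<eta>))"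
  have [measurable]: "?X m \<in> borel_measurable M" for m
    by (simp add: borel_prod[symmetric])
  have image: "weak_conv_m (\<lambda>m. distr M borel (\<lambda>\<omega>. h (?X m \<omega>))) (distr (normal_law \<sigma> \<Otimes>\<^sub>M normal_law \<tau>) borel h)"
    if h: "continuous_on UNIV h" for h
  proof -
    have "weak_conv_m (\<lambda>m. distr (distr M borel (?X m)) borel h)
        (distr (normal_law \<sigma> \<Otimes>\<^sub>M normal_law \<tau>) borel h)"
      by (rule weak_conv_top_continuous_image[OF conv h])
        (auto intro!: prob_space_distr prob_space_pair S.prob_space_axioms T.prob_space_axioms
          simp: borel_prod[symmetric] cong: sets_pair_measure_cong)
    then show ?thesis
      using borel_measurable_continuous_onI[OF h] by (simp add: distr_distr comp_def)
  qed
  have "distr (normal_law \<sigma> \<Otimes>\<^sub>M normal_law \<tau>) borel fst = distr (normal_law \<sigma> \<Otimes>\<^sub>M normal_law \<tau>) (normal_law \<sigma>) fst"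
    by (rule distr_cong) simp_all
  then have a: "weak_conv_m (\<lambda>m. distr M borel (\<lambda>\<omega>. sqrt (real m) * (a m \<omega> - \<alpha>))) (normal_law \<sigma>)"
    using image[of fst] by (simp add: T.distr_pair_fst continuous_on_fst)
  have "distr (normal_law \<sigma> \<Otimes>\<^sub>M normal_law \<tau>) borel snd = normal_law \<tau>"
  proof (rule measure_eqI)
    fix A assume "A \<in> sets (distr (normal_law \<sigma> \<Otimes>\<^sub>M normal_law \<tau>) borel snd)"
    then have A: "A \<in> sets borel" by simp
    have "emeasure (distr (normal_law \<sigma> \<Otimes>\<^sub>M normal_law \<tau>) borel snd) A
        = emeasure (normal_law \<sigma> \<Otimes>\<^sub>M normal_law \<tau>) (UNIV \<times> A)"
      using A by (subst emeasure_distr) (auto simp: space_pair_measure intro!: arg_cong2[where f = emeasure])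
    also have "\<dots> = emeasure (normal_law \<tau>) A"
      using A S.emeasure_space_1 by (subst T.emeasure_pair_measure_Times) simp_all
    finally show "emeasure (distr (normal_law \<sigma> \<Otimes>\<^sub>M normal_law \<tau>) borel snd) A = emeasure (normal_law \<tau>) A" .
  qed simp
  then have e: "weak_conv_m (\<lambda>m. distr M borel (\<lambda>\<omega>. sqrt (real m) * (e m \<omega> - \<eta>))) (normal_law \<tau>)"
    using image[of snd] by (simp add: continuous_on_snd)
  from null consider "\<alpha> = 0" "\<eta> \<noteq> 0" | "\<alpha> \<noteq> 0" "\<eta> = 0" | "\<alpha> = 0" "\<eta> = 0" by auto
  then show thesis
  proof cases
    case 1
    with a have "weak_conv_m (\<lambda>m. distr M borel (\<lambda>\<omega>. sqrt (real m) * a m \<omega>)) (normal_law \<sigma>)"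
      by simp
    from sobel_limit_one_null[OF this e v w pos 1(2)] that[of 1] show ?thesis by simp
  next
    case 2
    with e have "weak_conv_m (\<lambda>m. distr M borel (\<lambda>\<omega>. sqrt (real m) * e m \<omega>)) (normal_law \<tau>)"
      by simp
    from sobel_limit_one_null[OF this a w v pos(2,1) 2(1)] that[of 1] show ?thesis
      by (simp add: sobel_commute)
  next
    case 3
    with a e conv
    have a': "weak_conv_m (\<lambda>m. distr M borel (\<lambda>\<omega>. sqrt (real m) * a m \<omega>)) (normal_law \<sigma>)"
      and e': "weak_conv_m (\<lambda>m. distr M borel (\<lambda>\<omega>. sqrt (real m) * e m \<omega>)) (normal_law \<tau>)"
      and conv': "weak_conv_top (\<lambda>m. distr M borel (\<lambda>\<omega>. (sqrt (real m) * a m \<omega>, sqrt (real m) * e m \<omega>)))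
        (normal_law \<sigma> \<Otimes>\<^sub>M normal_law \<tau>)"
      by simp_all
    have "bounded_in_prob M (\<lambda>m \<omega>. sqrt (real m) * a m \<omega>)"
      by (rule weak_conv_m_imp_bounded_in_prob[OF a' real_distribution_normal_law isCont_cdf_normal_law])
         (simp_all add: pos)
    moreover have "bounded_in_prob M (\<lambda>m \<omega>. sqrt (real m) * e m \<omega>)"
      by (rule weak_conv_m_imp_bounded_in_prob[OF e' real_distribution_normal_law isCont_cdf_normal_law])
         (simp_all add: pos)
    ultimately show ?thesis
      using sobel_limit_both_null[OF conv' _ _ v w pos] by (intro that[of 2]) simp_all
  qed
qed

section \<open>Splitting the sample\<close>

text \<open>Coordinates are independent under a product measure and stay so after a map is applied
  to each, so the joint law is the product of the image laws.\<close>

lemma distr_PiM_coordinatewise: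
  assumes I: "I \<noteq> {}" and M: "\<And>i. i \<in> I \<Longrightarrow> prob_space (M i)"
    and f: "\<And>i. i \<in> I \<Longrightarrow> f i \<in> measurable (M i) (N i)"
  shows "distr (PiM I M) (PiM I N) (\<lambda>\<omega>. \<lambda>i\<in>I. f i (\<omega> i)) = PiM I (\<lambda>i. distr (M i) (N i) (f i))"
proof -
  interpret prob_space "PiM I M" by (intro prob_space_PiM M)
  have "indep_vars M (\<lambda>i \<omega>. \<omega> i) I"
  proof (subst indep_vars_iff_distr_eq_PiM'[OF I])
    have "distr (PiM I M) (PiM I M) (\<lambda>\<omega>. \<lambda>i\<in>I. \<omega> i) = distr (PiM I M) (PiM I M) (\<lambda>\<omega>. \<omega>)"
      by (rule distr_cong) (auto simp: space_PiM)
    also have "\<dots> = PiM I M" by simp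
    also have "\<dots> = PiM I (\<lambda>i. distr (PiM I M) (M i) (\<lambda>\<omega>. \<omega> i))"
      by (rule PiM_cong) (simp_all add: distr_PiM_component M)
    finally show "distr (PiM I M) (PiM I M) (\<lambda>\<omega>. \<lambda>i\<in>I. \<omega> i)
      = PiM I (\<lambda>i. distr (PiM I M) (M i) (\<lambda>\<omega>. \<omega> i))" .
  qed simp
  then have ind: "indep_vars N (\<lambda>i \<omega>. f i (\<omega> i)) I"
    by (rule indep_vars_compose2) (rule f)
  have rv: "(\<lambda>\<omega>. f i (\<omega> i)) \<in> measurable (PiM I M) (N i)" if "i \<in> I" for i
    by (rule measurable_compose[OF measurable_component_singleton[OF that, of M] f[OF that]])
  have "distr (PiM I M) (PiM I N) (\<lambda>\<omega>. \<lambda>i\<in>I. f i (\<omega> i))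
      = PiM I (\<lambda>i. distr (PiM I M) (N i) (\<lambda>\<omega>. f i (\<omega> i)))"
    using indep_vars_iff_distr_eq_PiM'[OF I rv] ind by simp
  also have "\<dots> = PiM I (\<lambda>i. distr (M i) (N i) (f i))"
  proof (rule PiM_cong)
    fix i assume i: "i \<in> I"
    have "distr (PiM I M) (N i) (\<lambda>\<omega>. f i (\<omega> i)) = distr (distr (PiM I M) (M i) (\<lambda>\<omega>. \<omega> i)) (N i) (f i)"
      by (subst distr_distr[OF f[OF i] measurable_component_singleton[OF i, of M]]) (simp add: comp_def)
    then show "distr (PiM I M) (N i) (\<lambda>\<omega>. f i (\<omega> i)) = distr (M i) (N i) (f i)"
      using distr_PiM_component[of I M i, OF M i] by simp
  qed simp
  finally show ?thesis .
qed

section \<open>The split statistic as a function of its arguments, and its limit law\<close>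

lemma split_t_cong: "(\<And>q. q \<in> {1..Q} \<Longrightarrow> x q = y q) \<Longrightarrow> split_t Q x = split_t Q y"
  unfolding split_t_def split_mean_def by (auto intro!: sum.cong arg_cong2[where f = "(/)"])

lemma split_t_restrict: "split_t Q (\<lambda>q\<in>{1..Q}. x q) = split_t Q x"
  by (rule split_t_cong) simp

lemma split_t_mult:
  assumes "0 < c"
  shows "split_t Q (\<lambda>q. c * x q) = split_t Q x"
proof -
  have m: "split_mean Q (\<lambda>q. c * x q) = c * split_mean Q x"
    by (simp add: split_mean_def flip: sum_distrib_left)
  have "(\<Sum>q\<in>{1..Q}. (c * x q - c * split_mean Q x)\<^sup>2) = c\<^sup>2 * (\<Sum>q\<in>{1..Q}. (x q - split_mean Q x)\<^sup>2)"
    by (simp add: sum_distrib_left power_mult_distrib flip: right_diff_distrib)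
  then have "sqrt ((\<Sum>q\<in>{1..Q}. (c * x q - c * split_mean Q x)\<^sup>2) / (real Q - 1))
      = c * sqrt ((\<Sum>q\<in>{1..Q}. (x q - split_mean Q x)\<^sup>2) / (real Q - 1))"
    using assms by (simp add: real_sqrt_mult flip: times_divide_eq_right)
  then show ?thesis
    using assms unfolding split_t_def m by simp
qed

lemma tendsto_split_t:
  assumes "\<And>q. q \<in> {1..Q} \<Longrightarrow> (\<lambda>r. y r q) \<longlonglongrightarrow> x q" and "2 \<le> Q" and "0 < split_ssq Q x"
  shows "(\<lambda>r. split_t Q (y r)) \<longlonglongrightarrow> split_t Q x"
  unfolding split_t_def using assms(2,3)
  by (intro tendsto_intros) (auto simp: split_mean_def split_ssq_def intro!: tendsto_intros assms(1))

lemma real_distribution_student_t: "2 \<le> Q \<Longrightarrow> real_distribution (student_t (real Q - 1))"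
proof -
  assume Q: "2 \<le> Q"
  interpret prob_space "std_normal_sample Q"
    by (intro prob_space_PiM prob_space_std_normal)
  show ?thesis
    unfolding distr_split_t_std_normal[OF Q, symmetric]
    by (rule real_distribution_distr) measurable
qed

text \<open>Skorohod's representation in each coordinate turns weak convergence of the product laws into
  almost sure convergence on a product space.\<close>

lemma weak_conv_split_t:
  fixes \<nu> :: "nat \<Rightarrow> nat \<Rightarrow> real measure"
  assumes Q: "2 \<le> Q" and \<nu>: "\<And>q r. real_distribution (\<nu> q r)"
    and conv: "\<And>q. weak_conv_m (\<nu> q) std_normal_distribution"
  shows "weak_conv_m (\<lambda>r. distr (PiM {1..Q} (\<lambda>q. \<nu> q r)) borel (split_t Q)) (student_t (real Q - 1))"
proof -
  have "\<exists>(\<Omega> :: real measure) Ys Y. prob_space \<Omega> \<and> (\<forall>r. Ys r \<in> measurable \<Omega> borel) \<and> (\<forall>r. distr \<Omega> borel (Ys r) = \<nu> q r) \<and>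
      Y \<in> measurable \<Omega> lborel \<and> distr \<Omega> borel Y = std_normal_distribution \<and>
      (\<forall>x\<in>space \<Omega>. (\<lambda>r. Ys r x) \<longlonglongrightarrow> Y x)" for q
    by (rule Skorohod[OF \<nu> real_dist_normal_dist conv])
  then obtain \<Omega> :: "nat \<Rightarrow> real measure" and Ys Y where
    S: "\<And>q. prob_space (\<Omega> q) \<and> (\<forall>r. Ys q r \<in> measurable (\<Omega> q) borel) \<and> (\<forall>r. distr (\<Omega> q) borel (Ys q r) = \<nu> q r) \<and>
      Y q \<in> measurable (\<Omega> q) lborel \<and> distr (\<Omega> q) borel (Y q) = std_normal_distribution \<and>
      (\<forall>x\<in>space (\<Omega> q). (\<lambda>r. Ys q r x) \<longlonglongrightarrow> Y q x)"
    by metis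
  have prob: "prob_space (\<Omega> q)" and [measurable]: "Ys q r \<in> borel_measurable (\<Omega> q)"
    and Ys: "distr (\<Omega> q) borel (Ys q r) = \<nu> q r"
    and [measurable]: "Y q \<in> borel_measurable (\<Omega> q)"
    and Y: "distr (\<Omega> q) borel (Y q) = std_normal_distribution"
    and lim: "x \<in> space (\<Omega> q) \<Longrightarrow> (\<lambda>r. Ys q r x) \<longlonglongrightarrow> Y q x" for q r x
    using S[of q] by (simp_all add: measurable_lborel1)
  \<comment> \<open>Skorohod's theorem yields a separate space for every q; on their product the
    coordinates are independent with the required marginals, simultaneously for all r and for the
    limit.\<close>
  let ?P = "PiM {1..Q} \<Omega>"
  interpret P: prob_space ?P by (intro prob_space_PiM prob)
  define Ts where "Ts r \<omega> = (\<lambda>q\<in>{1..Q}. Ys q r (\<omega> q))" for r \<omega>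
  define T where "T \<omega> = (\<lambda>q\<in>{1..Q}. Y q (\<omega> q))" for \<omega>
  have Ts_meas: "Ts r \<in> measurable ?P (PiM {1..Q} (\<lambda>_. borel))" for r
    unfolding Ts_def by measurable
  have T_meas: "T \<in> measurable ?P (PiM {1..Q} (\<lambda>_. borel))"
    unfolding T_def by measurable
  have Ts: "distr ?P (PiM {1..Q} (\<lambda>_. borel)) (Ts r) = PiM {1..Q} (\<lambda>q. \<nu> q r)" for r
    unfolding Ts_def by (subst distr_PiM_coordinatewise) (use Q in \<open>simp_all add: prob Ys\<close>)
  have T: "distr ?P (PiM {1..Q} (\<lambda>_. borel)) T = std_normal_sample Q"
    unfolding T_def by (subst distr_PiM_coordinatewise) (use Q in \<open>simp_all add: prob Y\<close>)
  have law_s: "distr (PiM {1..Q} (\<lambda>q. \<nu> q r)) borel (split_t Q) = distr ?P borel (\<lambda>\<omega>. split_t Q (Ts r \<omega>))" for r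
    unfolding Ts[symmetric] by (subst distr_distr[OF measurable_split_t Ts_meas]) (simp add: comp_def)
  have law: "student_t (real Q - 1) = distr ?P borel (\<lambda>\<omega>. split_t Q (T \<omega>))"
    unfolding distr_split_t_std_normal[OF Q, symmetric] T[symmetric]
    by (subst distr_distr[OF measurable_split_t T_meas]) (simp add: comp_def)
  have m1: "(\<lambda>\<omega>. split_t Q (Ts r \<omega>)) \<in> borel_measurable ?P" for r
    using Ts_meas measurable_split_t by (rule measurable_compose)
  have m2: "(\<lambda>\<omega>. split_t Q (T \<omega>)) \<in> borel_measurable ?P"
    using T_meas measurable_split_t by (rule measurable_compose)
  \<comment> \<open>The limit sample almost surely avoids the points where \<open>split_t\<close> is
    discontinuous.\<close>
  have "AE \<omega> in ?P. 0 < split_ssq Q (T \<omega>)"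
    using AE_std_normal_sample_ssq[OF Q] unfolding T[symmetric] by (rule AE_distrD[OF T_meas])
  then have ae: "AE \<omega> in ?P. (\<lambda>r. split_t Q (Ts r \<omega>)) \<longlonglongrightarrow> split_t Q (T \<omega>)"
    using AE_space
  proof eventually_elim
    case (elim \<omega>)
    show ?case
    proof (rule tendsto_split_t[OF _ Q elim(1)])
      fix q assume q: "q \<in> {1..Q}"
      with elim(2) have "\<omega> q \<in> space (\<Omega> q)" by (auto simp: space_PiM)
      from lim[OF this] q show "(\<lambda>r. Ts r \<omega> q) \<longlonglongrightarrow> T \<omega> q" by (simp add: Ts_def T_def)
    qed
  qed
  show ?thesis
    unfolding law_s
  proof (rule integral_bdd_continuous_conv_imp_weak_conv)
    show "real_distribution (distr ?P borel (\<lambda>\<omega>. split_t Q (Ts r \<omega>)))" for r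
      using m1 by (rule P.real_distribution_distr)
    show "real_distribution (student_t (real Q - 1))"
      using Q by (rule real_distribution_student_t)
    fix f :: "real \<Rightarrow> real" assume f: "\<And>x. isCont f x" "\<And>x. \<bar>f x\<bar> \<le> 1"
    then have fm [measurable]: "f \<in> borel_measurable borel"
      by (intro borel_measurable_continuous_onI) (simp add: continuous_on_eq_continuous_at)
    have "(\<lambda>r. \<integral>\<omega>. f (split_t Q (Ts r \<omega>)) \<partial>?P) \<longlonglongrightarrow> (\<integral>\<omega>. f (split_t Q (T \<omega>)) \<partial>?P)"
    proof (rule integral_dominated_convergence[where w = "\<lambda>_. 1"])
      show "AE \<omega> in ?P. (\<lambda>r. f (split_t Q (Ts r \<omega>))) \<longlonglongrightarrow> f (split_t Q (T \<omega>))"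
        using ae by eventually_elim (rule isCont_tendsto_compose[OF f(1)])
      show "integrable ?P (\<lambda>_. 1 :: real)" by (rule P.integrable_const)
    qed (use f(2) m1 m2 in \<open>auto intro: measurable_compose[OF _ fm]\<close>)
    then show "(\<lambda>r. integral\<^sup>L (distr ?P borel (\<lambda>\<omega>. split_t Q (Ts r \<omega>))) f)
        \<longlonglongrightarrow> integral\<^sup>L (student_t (real Q - 1)) f"
      unfolding law using m1 m2 by (simp add: integral_distr)
  qed
qed

section \<open>Sub-datasets of i.i.d. observations and random partitions\<close>

context prob_space
begin

context
  fixes S :: "'b measure" and Z :: "nat \<Rightarrow> 'a \<Rightarrow> 'b" and \<mu> :: "'b measure"
  assumes indep: "indep_vars (\<lambda>_. S) Z UNIV" and ident: "\<And>i. distr M S (Z i) = \<mu>"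
begin

lemma measurable_obs: "Z i \<in> measurable M S"
  using indep by (auto simp: indep_vars_def)

lemma prob_space_obs: "prob_space \<mu>"
  using prob_space_distr[OF measurable_obs[of 0]] by (simp add: ident)

lemma sets_obs: "sets \<mu> = sets S"
  using ident[of 0] by auto

text \<open>The whole sequence has the infinite product law, and an injective choice of coordinates
  of a product with equal factors is again such a product; only the number of chosen observations
  matters.\<close>

lemma distr_iid_reindex:
  assumes inj: "inj_on f {..<m::nat}"
  shows "distr M (PiM {..<m} (\<lambda>_. S)) (\<lambda>\<omega>. \<lambda>j\<in>{..<m}. Z (f j) \<omega>) = PiM {..<m} (\<lambda>_. \<mu>)"
proof -
  note measurable_obs [measurable]
  have sets: "sets (PiM A (\<lambda>_. \<mu>)) = sets (PiM A (\<lambda>_. S))" for A :: "nat set"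
    by (intro sets_PiM_cong) (simp_all add: sets_obs)
  have "distr M (PiM UNIV (\<lambda>_. S)) (\<lambda>\<omega>. \<lambda>i\<in>UNIV. Z i \<omega>) = PiM UNIV (\<lambda>_. \<mu>)"
    using indep_vars_iff_distr_eq_PiM[of UNIV Z "\<lambda>_. S"] indep by (simp add: ident)
  then have "PiM {..<m} (\<lambda>_. \<mu>) = distr (distr M (PiM UNIV (\<lambda>_. S)) (\<lambda>\<omega>. \<lambda>i\<in>UNIV. Z i \<omega>))
      (PiM {..<m} (\<lambda>_. \<mu>)) (\<lambda>\<omega>. \<lambda>n\<in>{..<m}. \<omega> (f n))"
    using distr_PiM_reindex[of UNIV "\<lambda>_. \<mu>" f "{..<m}"] inj by (simp add: prob_space_obs)
  also have "\<dots> = distr (distr M (PiM UNIV (\<lambda>_. S)) (\<lambda>\<omega>. \<lambda>i\<in>UNIV. Z i \<omega>))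
      (PiM {..<m} (\<lambda>_. S)) (\<lambda>\<omega>. \<lambda>n\<in>{..<m}. \<omega> (f n))"
    by (rule distr_cong) (simp_all add: sets)
  also have "\<dots> = distr M (PiM {..<m} (\<lambda>_. S)) (\<lambda>\<omega>. \<lambda>j\<in>{..<m}. Z (f j) \<omega>)"
    by (subst distr_distr) (simp_all add: comp_def)
  finally show ?thesis by simp
qed

lemma distr_subdata:
  assumes "finite I"
  shows "distr M (PiM {..<card I} (\<lambda>_. S)) (\<lambda>\<omega>. subdata I (\<lambda>i. Z i \<omega>))
    = distr M (PiM {..<card I} (\<lambda>_. S)) (\<lambda>\<omega>. \<lambda>j\<in>{..<card I}. Z j \<omega>)"
proof -
  have "inj_on ((!) (sorted_list_of_set I)) {..<card I}"
    using assms by (intro inj_on_nth) auto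
  from distr_iid_reindex[OF this] distr_iid_reindex[of "\<lambda>j. j" "card I"]
  show ?thesis by (simp add: subdata_def)
qed

text \<open>Since only the entries in I are read, statistics computed on disjoint index sets are
  functions of independent blocks.\<close>

lemma subdata_restrict: "finite I \<Longrightarrow> subdata I (restrict x I) = subdata I x"
proof -
  assume "finite I"
  then have "sorted_list_of_set I ! j \<in> I" if "j < card I" for j
    using that nth_mem[of j "sorted_list_of_set I"] by simp
  then show ?thesis by (auto simp: subdata_def)
qed

lemma measurable_subdata:
  assumes "finite I" "I \<subseteq> J" and m: "card I = m"
  shows "subdata I \<in> measurable (PiM J (\<lambda>_. S)) (PiM {..<m} (\<lambda>_. S))"
proof -
  have "sorted_list_of_set I ! j \<in> J" if "j < card I" for j
    using that assms nth_mem[of j "sorted_list_of_set I"] by auto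
  then show ?thesis unfolding subdata_def m[symmetric] by (intro measurable_restrict) simp
qed

context
  fixes T :: "nat \<Rightarrow> (nat \<Rightarrow> 'b) \<Rightarrow> real"
  assumes T: "\<And>m. T m \<in> borel_measurable (PiM {..<m} (\<lambda>_. S))"
begin

abbreviation stat_law :: "nat \<Rightarrow> real measure" where
  "stat_law m \<equiv> distr M borel (\<lambda>\<omega>. T m (\<lambda>i\<in>{..<m}. Z i \<omega>))"

lemma real_distribution_stat_law: "real_distribution (stat_law m)"
  by (intro real_distribution_distr measurable_compose[OF _ T] measurable_restrict measurable_obs)

lemma measurable_split_stat:
  assumes "\<And>q. q \<in> {1..Q} \<Longrightarrow> finite (d q) \<and> d q \<subseteq> J \<and> card (d q) = N q"
  shows "(\<lambda>x. split_t Q (\<lambda>q. T (N q) (subdata (d q) x))) \<in> borel_measurable (PiM J (\<lambda>_. S))"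
proof -
  have "(\<lambda>x. T (N q) (subdata (d q) x)) \<in> borel_measurable (PiM J (\<lambda>_. S))" if "q \<in> {1..Q}" for q
    using assms[OF that] by (intro measurable_compose[OF measurable_subdata T]) auto
  then have "(\<lambda>x. \<lambda>q\<in>{1..Q}. T (N q) (subdata (d q) x)) \<in> measurable (PiM J (\<lambda>_. S)) (PiM {1..Q} (\<lambda>_. borel))"
    by (intro measurable_restrict)
  from measurable_compose[OF this measurable_split_t] show ?thesis
    by (simp only: split_t_restrict)
qed

text \<open>Disjoint index sets select independent blocks, and each block has the law of an initial
  segment of the same size, so the joint law depends on the sizes alone.\<close>

lemma distr_split_fixed_partition:
  assumes Q: "0 < Q" and disj: "disjoint_family_on d {1..Q}"
    and d: "\<And>q. q \<in> {1..Q} \<Longrightarrow> finite (d q) \<and> card (d q) = N q"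
  shows "distr M borel (\<lambda>\<omega>. split_t Q (\<lambda>q. T (N q) (subdata (d q) (\<lambda>i. Z i \<omega>))))
    = distr (PiM {1..Q} (\<lambda>q. stat_law (N q))) borel (split_t Q)"
proof -
  note measurable_obs [measurable]
  have Tm: "(\<lambda>x. T (N q) (subdata (d q) x)) \<in> borel_measurable (PiM (d q) (\<lambda>_. S))" if "q \<in> {1..Q}" for q
    using d[OF that] by (intro measurable_compose[OF measurable_subdata T]) auto
  have "indep_vars (\<lambda>q. PiM (d q) (\<lambda>_. S)) (\<lambda>q \<omega>. restrict (\<lambda>i. Z i \<omega>) (d q)) {1..Q}"
    by (rule indep_vars_restrict[OF indep _ disj]) simp
  then have "indep_vars (\<lambda>_. borel) (\<lambda>q \<omega>. T (N q) (subdata (d q) (restrict (\<lambda>i. Z i \<omega>) (d q)))) {1..Q}"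
    by (rule indep_vars_compose2) (rule Tm)
  also have "?this \<longleftrightarrow> indep_vars (\<lambda>_. borel) (\<lambda>q \<omega>. T (N q) (subdata (d q) (\<lambda>i. Z i \<omega>))) {1..Q}"
    by (rule indep_vars_cong) (simp_all add: subdata_restrict d fun_eq_iff)
  finally have ind: "indep_vars (\<lambda>_. borel) (\<lambda>q \<omega>. T (N q) (subdata (d q) (\<lambda>i. Z i \<omega>))) {1..Q}" .
  then have rv [measurable]: "(\<lambda>\<omega>. T (N q) (subdata (d q) (\<lambda>i. Z i \<omega>))) \<in> borel_measurable M" if "q \<in> {1..Q}" for q
    using that unfolding indep_vars_def by blast
  have sub: "(\<lambda>\<omega>. subdata (d q) (\<lambda>i. Z i \<omega>)) \<in> measurable M (PiM {..<card (d q)} (\<lambda>_. S))" for q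
    unfolding subdata_def by measurable
  have "distr M borel (\<lambda>\<omega>. T (N q) (subdata (d q) (\<lambda>i. Z i \<omega>))) = stat_law (N q)" if q: "q \<in> {1..Q}" for q
  proof -
    have "distr M borel (\<lambda>\<omega>. T (N q) (subdata (d q) (\<lambda>i. Z i \<omega>)))
        = distr (distr M (PiM {..<N q} (\<lambda>_. S)) (\<lambda>\<omega>. subdata (d q) (\<lambda>i. Z i \<omega>))) borel (T (N q))"
      using sub[of q] d[OF q] by (subst distr_distr[OF T]) (simp_all add: comp_def)
    also have "distr M (PiM {..<N q} (\<lambda>_. S)) (\<lambda>\<omega>. subdata (d q) (\<lambda>i. Z i \<omega>))
        = distr M (PiM {..<N q} (\<lambda>_. S)) (\<lambda>\<omega>. \<lambda>j\<in>{..<N q}. Z j \<omega>)"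
      using distr_subdata[of "d q"] d[OF q] by simp
    also have "distr \<dots> borel (T (N q)) = stat_law (N q)"
      by (subst distr_distr[OF T]) (simp_all add: comp_def)
    finally show ?thesis .
  qed
  then have "PiM {1..Q} (\<lambda>q. distr M borel (\<lambda>\<omega>. T (N q) (subdata (d q) (\<lambda>i. Z i \<omega>))))
      = PiM {1..Q} (\<lambda>q. stat_law (N q))"
    by (intro PiM_cong refl)
  moreover have "indep_vars (\<lambda>_. borel) (\<lambda>q \<omega>. T (N q) (subdata (d q) (\<lambda>i. Z i \<omega>))) {1..Q} \<longleftrightarrow>
      distr M (PiM {1..Q} (\<lambda>_. borel)) (\<lambda>\<omega>. \<lambda>q\<in>{1..Q}. T (N q) (subdata (d q) (\<lambda>i. Z i \<omega>)))
      = PiM {1..Q} (\<lambda>q. distr M borel (\<lambda>\<omega>. T (N q) (subdata (d q) (\<lambda>i. Z i \<omega>))))"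
    using Q by (intro indep_vars_iff_distr_eq_PiM' rv) auto
  ultimately have "distr M (PiM {1..Q} (\<lambda>_. borel)) (\<lambda>\<omega>. \<lambda>q\<in>{1..Q}. T (N q) (subdata (d q) (\<lambda>i. Z i \<omega>)))
      = PiM {1..Q} (\<lambda>q. stat_law (N q))"
    using ind by simp
  moreover have "distr (distr M (PiM {1..Q} (\<lambda>_. borel))
        (\<lambda>\<omega>. \<lambda>q\<in>{1..Q}. T (N q) (subdata (d q) (\<lambda>i. Z i \<omega>)))) borel (split_t Q)
      = distr M borel (\<lambda>\<omega>. split_t Q (\<lambda>q. T (N q) (subdata (d q) (\<lambda>i. Z i \<omega>))))"
    by (subst distr_distr[OF measurable_split_t])
       (intro measurable_restrict rv, simp_all only: comp_def split_t_restrict)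
  ultimately show ?thesis by simp
qed

text \<open>Conditionally on the partition the split statistic has a law that does not depend on the
  partition, because the observations are exchangeable.\<close>

lemma distr_split_random_partition:
  fixes D :: "nat \<Rightarrow> 'a \<Rightarrow> nat set" and N :: "nat \<Rightarrow> nat"
  assumes Q: "0 < Q"
    and D: "\<And>\<omega>. \<omega> \<in> space M \<Longrightarrow> (\<Union>q\<in>{1..Q}. D q \<omega>) = {..<n} \<and>
      disjoint_family_on (\<lambda>q. D q \<omega>) {1..Q} \<and> (\<forall>q\<in>{1..Q}. card (D q \<omega>) = N q)"
    and ind: "indep_rvs M (PiM {..<n} (\<lambda>_. S)) (\<lambda>\<omega>. \<lambda>i\<in>{..<n}. Z i \<omega>)
        (count_space UNIV) (\<lambda>\<omega>. \<lambda>q\<in>{1..Q}. D q \<omega>)"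
  shows "distr M borel (\<lambda>\<omega>. split_t Q (\<lambda>q. T (N q) (subdata (D q \<omega>) (\<lambda>i. Z i \<omega>))))
    = distr (PiM {1..Q} (\<lambda>q. stat_law (N q))) borel (split_t Q)"
    (is "distr M borel ?H = ?L")
proof -
  \<comment> \<open>As extensional functions the possible partitions form a finite set; the events
    \<open>E d\<close> cut the space into finitely many pieces on which the partition is
    constant.\<close>
  define V where "V = {d \<in> {1..Q} \<rightarrow>\<^sub>E Pow {..<n}. disjoint_family_on d {1..Q} \<and> (\<forall>q\<in>{1..Q}. card (d q) = N q)}"
  define E where "E d = {\<omega> \<in> space M. (\<lambda>q\<in>{1..Q}. D q \<omega>) = d}" for d
  define H where "H d x = split_t Q (\<lambda>q. T (N q) (subdata (d q) x))" for d x
  have finV: "finite V"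
    unfolding V_def by (rule finite_subset[OF _ finite_PiE[of "{1..Q}" "\<lambda>_. Pow {..<n}"]]) auto
  have V: "finite (d q) \<and> d q \<subseteq> {..<n} \<and> card (d q) = N q" if "d \<in> V" "q \<in> {1..Q}" for d q
    using that finite_subset[of "d q" "{..<n}"] by (auto simp: V_def PiE_iff)
  have in_V: "(\<lambda>q\<in>{1..Q}. D q \<omega>) \<in> V" if "\<omega> \<in> space M" for \<omega>
    using D[OF that] unfolding V_def by (auto simp: disjoint_family_on_def)
  have D_meas: "(\<lambda>\<omega>. \<lambda>q\<in>{1..Q}. D q \<omega>) \<in> measurable M (count_space UNIV)"
    and Z_meas: "(\<lambda>\<omega>. \<lambda>i\<in>{..<n}. Z i \<omega>) \<in> measurable M (PiM {..<n} (\<lambda>_. S))"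
    using ind by (simp_all add: indep_rvs_def)
  have E_eq: "E d = (\<lambda>\<omega>. \<lambda>q\<in>{1..Q}. D q \<omega>) -` {d} \<inter> space M" for d
    by (auto simp: E_def)
  have E [measurable]: "E d \<in> sets M" for d
    unfolding E_eq by (rule measurable_sets[OF D_meas]) simp
  have E_disj: "disjoint_family_on (\<lambda>d. E d \<inter> B d) V" for B :: "_ \<Rightarrow> 'a set"
    by (auto simp: disjoint_family_on_def E_def)
  have H_restrict: "H d (\<lambda>i\<in>{..<n}. Z i \<omega>) = H d (\<lambda>i. Z i \<omega>)" if "d \<in> V" for d \<omega>
    unfolding H_def
  proof (rule split_t_cong)
    fix q assume q: "q \<in> {1..Q}"
    have "subdata (d q) (\<lambda>i\<in>{..<n}. Z i \<omega>) = subdata (d q) (restrict (\<lambda>i\<in>{..<n}. Z i \<omega>) (d q))"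
      by (rule subdata_restrict[symmetric]) (use V[OF that q] in simp)
    also have "restrict (\<lambda>i\<in>{..<n}. Z i \<omega>) (d q) = restrict (\<lambda>i. Z i \<omega>) (d q)"
      using V[OF that q] by (auto simp: restrict_def fun_eq_iff)
    also have "subdata (d q) \<dots> = subdata (d q) (\<lambda>i. Z i \<omega>)"
      by (rule subdata_restrict) (use V[OF that q] in simp)
    finally show "T (N q) (subdata (d q) (\<lambda>i\<in>{..<n}. Z i \<omega>)) = T (N q) (subdata (d q) (\<lambda>i. Z i \<omega>))"
      by (simp only:)
  qed
  have H_meas: "H d \<in> borel_measurable (PiM {..<n} (\<lambda>_. S))" if "d \<in> V" for d
    unfolding H_def by (rule measurable_split_stat) (rule V[OF that])
  have HZ_meas: "(\<lambda>\<omega>. H d (\<lambda>i. Z i \<omega>)) \<in> borel_measurable M" if "d \<in> V" for d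
    using measurable_compose[OF Z_meas H_meas[OF that]] by (simp add: H_restrict[OF that])
  have H_law: "distr M borel (\<lambda>\<omega>. H d (\<lambda>i. Z i \<omega>)) = ?L" if "d \<in> V" for d
    unfolding H_def using that V[OF that]
    by (intro distr_split_fixed_partition Q) (auto simp: V_def)
  have H_on_E: "?H \<omega> = H d (\<lambda>i. Z i \<omega>)" if "\<omega> \<in> E d" for d \<omega>
    unfolding H_def using that by (intro split_t_cong) (auto simp: E_def)
  have E_cover: "\<omega> \<in> E (\<lambda>q\<in>{1..Q}. D q \<omega>)" if "\<omega> \<in> space M" for \<omega>
    using that by (simp add: E_def)
  have split: "?H -` B \<inter> space M = (\<Union>d\<in>V. E d \<inter> ((\<lambda>\<omega>. H d (\<lambda>i. Z i \<omega>)) -` B \<inter> space M))" for B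
  proof (intro equalityI subsetI)
    fix \<omega> assume "\<omega> \<in> ?H -` B \<inter> space M"
    then have \<omega>: "\<omega> \<in> space M" "?H \<omega> \<in> B" by simp_all
    show "\<omega> \<in> (\<Union>d\<in>V. E d \<inter> ((\<lambda>\<omega>. H d (\<lambda>i. Z i \<omega>)) -` B \<inter> space M))"
      using \<omega> E_cover[OF \<omega>(1)] H_on_E[OF E_cover[OF \<omega>(1)]] by (intro UN_I[OF in_V[OF \<omega>(1)]]) simp
  next
    fix \<omega> assume "\<omega> \<in> (\<Union>d\<in>V. E d \<inter> ((\<lambda>\<omega>. H d (\<lambda>i. Z i \<omega>)) -` B \<inter> space M))"
    then obtain d where d: "\<omega> \<in> E d" "H d (\<lambda>i. Z i \<omega>) \<in> B" "\<omega> \<in> space M" by blast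
    then show "\<omega> \<in> ?H -` B \<inter> space M" using H_on_E[OF d(1)] by simp
  qed
  have part: "(\<lambda>\<omega>. H d (\<lambda>i. Z i \<omega>)) -` B \<inter> space M \<in> sets M" if "d \<in> V" "B \<in> sets borel" for d B
    using measurable_sets[OF HZ_meas[OF that(1)] that(2)] .
  \<comment> \<open>Measurability over a random partition comes from the finite decomposition, each
    piece involving a fixed partition only.\<close>
  have H_whole: "?H \<in> borel_measurable M"
  proof (rule measurableI)
    fix B :: "real set" assume "B \<in> sets borel"
    then show "?H -` B \<inter> space M \<in> sets M"
      unfolding split by (intro sets.finite_UN[OF finV] sets.Int[OF E] part)
  qed simp
  have "indep_set (sigma_sets (space M) {(\<lambda>\<omega>. \<lambda>i\<in>{..<n}. Z i \<omega>) -` A \<inter> space M |A. A \<in> sets (PiM {..<n} (\<lambda>_. S))})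
      (sigma_sets (space M) {(\<lambda>\<omega>. \<lambda>q\<in>{1..Q}. D q \<omega>) -` A \<inter> space M |A. A \<in> sets (count_space UNIV)})"
    using ind by (simp add: indep_rvs_def)
  note indep' = indep_setD[OF this]
  \<comment> \<open>\<open>E d\<close> is an event of the partition and the other one an event of
    the data, so the probability factorises; by \<open>H_law\<close> the second factor is the same
    for every \<open>d\<close>.\<close>
  have factor: "prob (E d \<inter> ((\<lambda>\<omega>. H d (\<lambda>i. Z i \<omega>)) -` B \<inter> space M)) = prob (E d) * measure ?L B"
    if d: "d \<in> V" and B: "B \<in> sets borel" for d B
  proof -
    have "(\<lambda>\<omega>. H d (\<lambda>i. Z i \<omega>)) -` B \<inter> space M
        = (\<lambda>\<omega>. \<lambda>i\<in>{..<n}. Z i \<omega>) -` (H d -` B \<inter> space (PiM {..<n} (\<lambda>_. S))) \<inter> space M"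
      using measurable_space[OF Z_meas] by (auto simp: H_restrict[OF d])
    moreover have "H d -` B \<inter> space (PiM {..<n} (\<lambda>_. S)) \<in> sets (PiM {..<n} (\<lambda>_. S))"
      using measurable_sets[OF H_meas[OF d] B] .
    ultimately have 1: "(\<lambda>\<omega>. H d (\<lambda>i. Z i \<omega>)) -` B \<inter> space M \<in>
        sigma_sets (space M) {(\<lambda>\<omega>. \<lambda>i\<in>{..<n}. Z i \<omega>) -` A \<inter> space M |A. A \<in> sets (PiM {..<n} (\<lambda>_. S))}"
      by (intro sigma_sets.Basic) blast
    have 2: "E d \<in> sigma_sets (space M) {(\<lambda>\<omega>. \<lambda>q\<in>{1..Q}. D q \<omega>) -` A \<inter> space M |A. A \<in> sets (count_space UNIV)}"
      unfolding E_eq by (intro sigma_sets.Basic) auto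
    have "prob ((\<lambda>\<omega>. H d (\<lambda>i. Z i \<omega>)) -` B \<inter> space M) = measure ?L B"
      unfolding H_law[OF d, symmetric] by (rule measure_distr[OF HZ_meas[OF d] B, symmetric])
    with indep'[OF 1 2] show ?thesis by (simp add: Int_commute mult.commute)
  qed
  have meas: "measure (distr M borel ?H) B = (\<Sum>d\<in>V. prob (E d)) * measure ?L B" if B: "B \<in> sets borel" for B
  proof -
    have "measure (distr M borel ?H) B = prob (\<Union>d\<in>V. E d \<inter> ((\<lambda>\<omega>. H d (\<lambda>i. Z i \<omega>)) -` B \<inter> space M))"
      using H_whole B by (simp add: measure_distr split)
    also have "\<dots> = (\<Sum>d\<in>V. prob (E d \<inter> ((\<lambda>\<omega>. H d (\<lambda>i. Z i \<omega>)) -` B \<inter> space M)))"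
      by (intro finite_measure_finite_Union[OF finV _ E_disj] image_subsetI sets.Int[OF E] part B)
    also have "\<dots> = (\<Sum>d\<in>V. prob (E d) * measure ?L B)"
      using factor[OF _ B] by (intro sum.cong) auto
    finally show ?thesis by (simp add: sum_distrib_right)
  qed
  interpret L1: prob_space "distr M borel ?H" using H_whole by (rule prob_space_distr)
  interpret PI: prob_space "PiM {1..Q} (\<lambda>q. stat_law (N q))"
    using real_distribution_stat_law by (intro prob_space_PiM) (auto simp: real_distribution_def)
  have sets: "sets (PiM {1..Q} (\<lambda>q. stat_law (N q))) = sets (PiM {1..Q} (\<lambda>_. borel))"
    by (rule sets_PiM_cong) simp_all
  have "split_t Q \<in> borel_measurable (PiM {1..Q} (\<lambda>q. stat_law (N q)))"
    unfolding measurable_cong_sets[OF sets refl] by (rule measurable_split_t)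
  then interpret L2: prob_space ?L by (rule PI.prob_space_distr)
  have "measure (distr M borel ?H) UNIV = 1" "measure ?L UNIV = 1"
    using L1.prob_space L2.prob_space unfolding space_distr space_borel .
  \<comment> \<open>Both laws have total mass 1, so evaluating \<open>meas\<close> at the whole line
    shows that the weights add up to 1.\<close>
  with meas[OF sets.top[of borel, unfolded space_borel]] have one: "(\<Sum>d\<in>V. prob (E d)) = 1" by (simp only: mult_1_right)
  show ?thesis
  proof (rule measure_eqI)
    fix B assume "B \<in> sets (distr M borel ?H)"
    then have "B \<in> sets borel" by (simp only: sets_distr)
    from meas[OF this] have "measure (distr M borel ?H) B = measure ?L B"
      unfolding one mult_1_left .
    then show "emeasure (distr M borel ?H) B = emeasure ?L B"
      unfolding L1.emeasure_eq_measure L2.emeasure_eq_measure by (rule arg_cong)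
  qed (simp only: sets_distr)
qed

end

end

end

text \<open>\<open>g\<close> need not be monotone: block sizes may fluctuate as long as they tend to
  infinity.\<close>

lemma weak_conv_m_compose:
  assumes "weak_conv_m \<mu>s \<mu>" "filterlim g at_top sequentially"
  shows "weak_conv_m (\<lambda>r. \<mu>s (g r)) \<mu>"
  using assms(1) unfolding weak_conv_m_def weak_conv_def
  by (auto intro: filterlim_compose[OF _ assms(2)])

theorem theorem3:
  fixes P :: "'a measure"
    and Z :: "nat \<Rightarrow> 'a \<Rightarrow> 'p::finite obs"
    and \<mu> :: "'p obs measure"
    and K k Q :: nat
    and fam :: outcome_family
    and \<theta> :: "'p params"
    and est :: "nat \<Rightarrow> (nat \<Rightarrow> 'p obs) \<Rightarrow> 'p params"
    and va ve :: "nat \<Rightarrow> (nat \<Rightarrow> 'p obs) \<Rightarrow> real"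
    and \<sigma>\<^sub>\<alpha> \<sigma>\<^sub>\<eta> :: real
  assumes k: "k \<in> {1..K}" and Q: "Q \<ge> 2"
    and model: "mediation_model K fam \<theta> \<mu>"
    and P: "prob_space P"
    and indep: "prob_space.indep_vars P (\<lambda>_. obs_space K) Z UNIV"
    and ident: "\<And>i. distr P (obs_space K) (Z i) = \<mu>"
    and mle: "mle_estimator K fam est"
    and meas:
      "\<And>m. (\<lambda>x. alpha (est m x) k) \<in> borel_measurable (data_space K m)"
      "\<And>m. (\<lambda>x. composite K (est m x) k) \<in> borel_measurable (data_space K m)"
      "\<And>m. va m \<in> borel_measurable (data_space K m)"
      "\<And>m. ve m \<in> borel_measurable (data_space K m)"
    and pos: "\<sigma>\<^sub>\<alpha> > 0" "\<sigma>\<^sub>\<eta> > 0"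
    and asymptotic_normality:
      "weak_conv_top
         (\<lambda>m. distr P borel (\<lambda>\<omega>. let x = (\<lambda>i\<in>{..<m}. Z i \<omega>) in
            (sqrt (real m) * (alpha (est m x) k - alpha \<theta> k),
             sqrt (real m) * (composite K (est m x) k - composite K \<theta> k))))
         (density lborel (normal_density 0 \<sigma>\<^sub>\<alpha>) \<Otimes>\<^sub>M density lborel (normal_density 0 \<sigma>\<^sub>\<eta>))"
    and consistency:
      "conv_in_prob P (\<lambda>m \<omega>. va m (\<lambda>i\<in>{..<m}. Z i \<omega>)) (\<sigma>\<^sub>\<alpha>\<^sup>2)"
      "conv_in_prob P (\<lambda>m \<omega>. ve m (\<lambda>i\<in>{..<m}. Z i \<omega>)) (\<sigma>\<^sub>\<eta>\<^sup>2)"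
    and H0: "alpha \<theta> k * composite K \<theta> k = 0"
  shows
    "(\<forall>(N :: nat \<Rightarrow> nat \<Rightarrow> nat) (D :: nat \<Rightarrow> nat \<Rightarrow> 'a \<Rightarrow> nat set).
        (\<forall>r. random_partition P K Z Q (N r) (D r)) \<and>
        filterlim (\<lambda>r. Min (N r ` {1..Q})) at_top sequentially \<longrightarrow>
        weak_conv_m (\<lambda>r. distr P borel (split_sobel K k est va ve Z Q (N r) (D r)))
          (student_t (real Q - 1)))
     \<and>
     (\<forall>(n :: nat \<Rightarrow> nat) (D :: nat \<Rightarrow> nat \<Rightarrow> 'a \<Rightarrow> nat set).
        (\<forall>r. Q dvd n r \<and> random_partition P K Z Q (\<lambda>q. n r div Q) (D r)) \<and>
        filterlim n at_top sequentially \<longrightarrow>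
        weak_conv_m (\<lambda>r. distr P borel (split_sobel K k est va ve Z Q (\<lambda>q. n r div Q) (D r)))
          (student_t (real Q - 1)))"
proof -
  interpret prob_space P by (rule P)
  let ?S = "obs_space K :: 'p obs measure"
  have data_space: "data_space K m = PiM {..<m} (\<lambda>_. ?S)" for m
    by (simp add: data_space_def)
  have Z [measurable]: "Z i \<in> measurable P ?S" for i
    using indep by (auto simp: indep_vars_def)
  let ?x = "\<lambda>m \<omega>. \<lambda>i\<in>{..<m}. Z i \<omega>"
  have x: "?x m \<in> measurable P (data_space K m)" for m
    unfolding data_space by (intro measurable_restrict Z)
  define a where "a m \<omega> = alpha (est m (?x m \<omega>)) k" for m \<omega>
  define e where "e m \<omega> = composite K (est m (?x m \<omega>)) k" for m \<omega>
  define v where "v m \<omega> = va m (?x m \<omega>)" for m \<omega>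
  define w where "w m \<omega> = ve m (?x m \<omega>)" for m \<omega>
  have [measurable]: "a m \<in> borel_measurable P" "e m \<in> borel_measurable P"
      "v m \<in> borel_measurable P" "w m \<in> borel_measurable P" for m
    unfolding a_def e_def v_def w_def by (rule measurable_compose[OF x], rule meas)+
  have "weak_conv_top (\<lambda>m. distr P borel (\<lambda>\<omega>.
        (sqrt (real m) * (a m \<omega> - alpha \<theta> k), sqrt (real m) * (e m \<omega> - composite K \<theta> k))))
      (normal_law \<sigma>\<^sub>\<alpha> \<Otimes>\<^sub>M normal_law \<sigma>\<^sub>\<eta>)"
    using asymptotic_normality by (simp add: a_def e_def Let_def)
  moreover have "tends_in_prob P v (\<sigma>\<^sub>\<alpha>\<^sup>2)" "tends_in_prob P w (\<sigma>\<^sub>\<eta>\<^sup>2)"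
    using consistency by (simp_all add: v_def[abs_def] w_def[abs_def] conv_in_prob_iff)
  ultimately obtain c where c: "0 < c" and sobel: "weak_conv_m (\<lambda>m. distr P borel (\<lambda>\<omega>.
      c * sobel (sqrt (real m) * a m \<omega> / sqrt (v m \<omega>)) (sqrt (real m) * e m \<omega> / sqrt (w m \<omega>))))
    std_normal_distribution"
    by (rule sobel_limit_null[OF _ _ _ pos H0]) simp_all
  \<comment> \<open>The constant is built into the statistic to make its limit standard normal;
    \<open>split_t_mult\<close> removes it again in \<open>law\<close>.\<close>
  define T where "T m x = c * sobel_stat K k est va ve m x" for m x
  have T: "T m \<in> borel_measurable (PiM {..<m} (\<lambda>_. ?S))" for m
  proof -
    note [measurable] = meas[of m, unfolded data_space]
    show ?thesis unfolding T_def sobel_stat_def sobel_def by measurable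
  qed
  have lim: "weak_conv_m (\<lambda>m. distr P borel (\<lambda>\<omega>. T m (?x m \<omega>))) std_normal_distribution"
    using sobel by (simp add: T_def sobel_stat_def a_def e_def v_def w_def)
  have stat: "real_distribution (distr P borel (\<lambda>\<omega>. T m (?x m \<omega>)))" for m
    by (rule real_distribution_distr) (rule measurable_compose[OF x[unfolded data_space] T])
  have law: "distr P borel (split_sobel K k est va ve Z Q N D)
      = distr (PiM {1..Q} (\<lambda>q. distr P borel (\<lambda>\<omega>. T (N q) (?x (N q) \<omega>)))) borel (split_t Q)"
    if "random_partition P K Z Q N D" for N D
  proof -
    have "split_sobel K k est va ve Z Q N D = (\<lambda>\<omega>. split_t Q (\<lambda>q. T (N q) (subdata (D q \<omega>) (\<lambda>i. Z i \<omega>))))"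
      using split_t_mult[OF c] by (simp add: fun_eq_iff split_sobel_def T_def)
    then show ?thesis
      using that Q distr_split_random_partition[OF indep ident T, where Q = Q and D = D and N = N]
      by (simp add: random_partition_def Let_def data_space)
  qed
  have main: "weak_conv_m (\<lambda>r. distr P borel (split_sobel K k est va ve Z Q (N r) (D r))) (student_t (real Q - 1))"
    if D: "\<And>r. random_partition P K Z Q (N r) (D r)"
      and N: "\<And>q. q \<in> {1..Q} \<Longrightarrow> filterlim (\<lambda>r. N r q) at_top sequentially" for N D
  proof -
    \<comment> \<open>\<open>weak_conv_split_t\<close> asks for convergence at every natural number
      q, but the sizes are controlled on {1..Q} only. Other indices borrow the size of block 1,
      which the product over {1..Q} does not see.\<close>
    define N' where "N' r q = N r (if q \<in> {1..Q} then q else 1)" for r q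
    have "filterlim (\<lambda>r. N' r q) at_top sequentially" for q
      unfolding N'_def by (rule N) (use Q in auto)
    from weak_conv_m_compose[OF lim this]
    have "weak_conv_m (\<lambda>r. distr (PiM {1..Q} (\<lambda>q. distr P borel (\<lambda>\<omega>. T (N' r q) (?x (N' r q) \<omega>))))
        borel (split_t Q)) (student_t (real Q - 1))"
      by (rule weak_conv_split_t[where \<nu> = "\<lambda>q r. distr P borel (\<lambda>\<omega>. T (N' r q) (?x (N' r q) \<omega>))", OF Q stat])
    moreover have eq: "PiM {1..Q} (\<lambda>q. distr P borel (\<lambda>\<omega>. T (N' r q) (?x (N' r q) \<omega>)))
        = PiM {1..Q} (\<lambda>q. distr P borel (\<lambda>\<omega>. T (N r q) (?x (N r q) \<omega>)))" for r
      by (rule PiM_cong) (simp_all add: N'_def)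
    ultimately show ?thesis by (simp only: law[OF D] eq)
  qed
  show ?thesis
  proof (intro conjI allI impI; elim conjE)
    fix N :: "nat \<Rightarrow> nat \<Rightarrow> nat" and D :: "nat \<Rightarrow> nat \<Rightarrow> 'a \<Rightarrow> nat set"
    assume D: "\<forall>r. random_partition P K Z Q (N r) (D r)"
      and N: "filterlim (\<lambda>r. Min (N r ` {1..Q})) at_top sequentially"
    have "filterlim (\<lambda>r. N r q) at_top sequentially" if "q \<in> {1..Q}" for q
      by (rule filterlim_at_top_mono[OF N]) (use that in simp)
    with D show "weak_conv_m (\<lambda>r. distr P borel (split_sobel K k est va ve Z Q (N r) (D r)))
        (student_t (real Q - 1))"
      by (intro main) simp_all
  next
    fix n :: "nat \<Rightarrow> nat" and D :: "nat \<Rightarrow> nat \<Rightarrow> 'a \<Rightarrow> nat set"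
    assume D: "\<forall>r. Q dvd n r \<and> random_partition P K Z Q (\<lambda>q. n r div Q) (D r)"
      and n: "filterlim n at_top sequentially"
    have "filterlim (\<lambda>m. m div Q) at_top sequentially"
      unfolding filterlim_at_top
    proof
      fix b :: nat
      show "eventually (\<lambda>m. b \<le> m div Q) sequentially"
        using eventually_ge_at_top[of "b * Q"]
        by eventually_elim (use Q in \<open>simp add: less_eq_div_iff_mult_less_eq\<close>)
    qed
    from filterlim_compose[OF this n] D
    show "weak_conv_m (\<lambda>r. distr P borel (split_sobel K k est va ve Z Q (\<lambda>q. n r div Q) (D r)))
        (student_t (real Q - 1))"
      by (intro main) simp_all
  qed
qed

end
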